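(* Let $\vec s=(s_1,\dots,s_k)\subset[n]$ be an activation sequence of length $k\ge 1$. Then the cluster variable $Y_{\vec s}$ of the seed $\tau_n^{\vec s}$ is given in terms of the initial cluster variables $X_1,\dots,X_n$ by $$Y_{\vec s}=\frac{\displaystyle\sum_{i=1}^{k}\bigg[\Big(\prod_{1\le j\le k,\ j\neq i}A_{s_j}\Big)\Big(\prod_{1\le j\le n,\ j\neq s_i}X_j\Big)\bigg]+\prod_{i=1}^{k}A_{s_i}}{\displaystyle\prod_{i=1}^k X_{s_i}}.$$ Consequently, for (non-empty) activation sequences $\vec s,\vec s'\subset[n]$ with underlying (unordered) sets $s,s'$, one has $Y_{\vec s}=Y_{\vec s'}$ if and only if $s=s'$.
   Context: Setting. $[n]=\{1,\dots,n\}$; $R=\mathbb{Z}[A_1,\dots,A_n]$ with $A_1,\dots,A_n$ independent indeterminates; $\mathcal{F}$ is the field of rational functions in $X_1,\dots,X_n$ over $\mathrm{Frac}(R)$. Empty products equal $1$. Seeds. A seed of rank $n$ in $\mathcal{F}$ is a pair $(\mathbf{X},\mathbf{F})$ with $\mathbf{X}=\{X_1,\dots,X_n\}$ a transcendence basis of $\mathcal{F}$ over $\mathrm{Frac}(R)$ generating $\mathcal F$ (the cluster) and $\mathbf{F}=\{F_1,\dots,F_n\}\subset R[X_1,\dots,X_n]$ (exchange polynomials, $F_i$ attached to $X_i$) such that each $F_i$ is irreducible in $R[X_1,\dots,X_n]$, is not divisible by any $X_j$, and does not involve $X_i$. For a seed, $\hat F_i$ denotes the unique Laurent polynomial $\hat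 F_i=\big(\prod_{j\ne i}X_j^{a_j}\big)F_i$ with integers $a_j\le 0$ such that for every $j\neq i$ the Laurent polynomial $\hat F_i|_{X_j\leftarrow F_j/X}$ lies in $R[X_1^{\pm1},\dots,X_{j-1}^{\pm1},X^{\pm1},X_{j+1}^{\pm1},\dots,X_n^{\pm1}]$ and is not divisible by $F_j$ in that ring. Mutation. The mutation $\mu_i$ of $(\mathbf{X},\mathbf{F})$ at $i$ is the seed $(\mathbf{X}',\mathbf{F}')$ with $X'_j=X_j$ for $j\ne i$, $X'_i=\hat F_i/X_i$, and: $F'_j=F_j$ if $F_j$ does not depend on $X_i$; otherwise put $G_j=F_j|_{X_i\leftarrow (\hat F_i|_{X_j\leftarrow 0})/X'_i}$, let $H_j$ be $G_j$ with all common factors in $R[X_1,\dots,\widehat{X_i},\dots,\widehat{X_j},\dots,X_n]$ (hats mean omission) with $\hat F_i|_{X_j\leftarrow 0}$ divided out (until none remain), and $F'_j=MH_j$, where $M$ is the Laurent monomial in the new cluster variables other than $X_j'$ making $F'_j$ a polynomial not divisible by any cluster variable. This defines $F'_j$ up to a unit of $R$; the units are chosen consistently so that, for the seeds $\tau_n^{\vec s}$ below and each $\sigma\notin\vec s$, the exchange polynomial attached to $X_\sigma$ is $\big(\prod_{r=1}^{k}A_{s_r}\big)\big(\prod_{\rho\notin \vec s,\,\rho\neq\sigma}X_\rho\big)+A_\sigma Y_{\vec s}$ (rather than its negative), where $Y_{\vec s}$ is read as $1$ when $k=0$. The seed $\tau_n$ has cluster variables $X_1,\dots,X_n$ and exchange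 polynomials $F_i=A_i+\prod_{j\ne i}X_j$, $i\in[n]$. Activation sequences. An activation sequence $\vec s=(s_1,\dots,s_k)\subset[n]$ of length $k$ is an ordered subset of $[n]$ (distinct elements); its underlying set is $s=\{s_1,\dots,s_k\}$. Put $\tau_n^{\vec s}=\mu_{s_k}\cdots\mu_{s_1}(\tau_n)$. For $k\ge1$, $Y_{\vec s}$ denotes the new cluster variable created by the last mutation (at $s_k$), i.e. the cluster variable of $\tau_n^{\vec s}$ replacing $X_{s_k}$. *)

theory Defs
  imports
    "HOL-Library.Poly_Mapping"
    "HOL-Computational_Algebra.Polynomial_Factorial"
begin

text \<open>
  The index set $[n]$ is an arbitrary type \<open>'n\<close> of sort \<open>{finite, linorder}\<close>, with
  $n$ its cardinality; the order is only there so that the polynomial types below are integral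
  domains.  Polynomials with exponents in \<open>nat\<close> or \<open>int\<close> are finitely supported maps from
  exponent vectors to coefficients, so the Laurent polynomial ring is again a type.
\<close>

type_synonym 'n coeffs = "('n \<Rightarrow>\<^sub>0 nat) \<Rightarrow>\<^sub>0 int"
type_synonym 'n pol = "('n \<Rightarrow>\<^sub>0 nat) \<Rightarrow>\<^sub>0 'n coeffs"
type_synonym 'n laurent = "('n \<Rightarrow>\<^sub>0 int) \<Rightarrow>\<^sub>0 'n coeffs"
type_synonym 'n ratfun = "(('n \<Rightarrow>\<^sub>0 nat) \<Rightarrow>\<^sub>0 'n coeffs fract) fract"

definition const :: "'r \<Rightarrow> (('n \<Rightarrow>\<^sub>0 'e::zero) \<Rightarrow>\<^sub>0 'r::zero)" where
  "const r = Poly_Mapping.single 0 r"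

definition var :: "'n \<Rightarrow> (('n \<Rightarrow>\<^sub>0 'e::zero_neq_one) \<Rightarrow>\<^sub>0 'r::zero_neq_one)" where
  "var i = Poly_Mapping.single (Poly_Mapping.single i 1) 1"

definition involves :: "'n \<Rightarrow> (('n \<Rightarrow>\<^sub>0 'e::zero) \<Rightarrow>\<^sub>0 'r::zero) \<Rightarrow> bool" where
  "involves i p \<longleftrightarrow> (\<exists>m\<in>Poly_Mapping.keys p. Poly_Mapping.lookup m i \<noteq> 0)"

text \<open>
  Substitution of \<open>v i\<close> for the \<open>i\<close>-th variable, the coefficients being mapped by \<open>c\<close>.
\<close>

definition peval :: "('r::zero \<Rightarrow> 's::comm_semiring_1) \<Rightarrow> ('n::finite \<Rightarrow> 's) \<Rightarrow>
    (('n \<Rightarrow>\<^sub>0 nat) \<Rightarrow>\<^sub>0 'r) \<Rightarrow> 's" where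
  "peval c v p = (\<Sum>m\<in>Poly_Mapping.keys p.
     c (Poly_Mapping.lookup p m) * (\<Prod>i\<in>UNIV. v i ^ Poly_Mapping.lookup m i))"

definition leval :: "('r::zero \<Rightarrow> 'f::field) \<Rightarrow> ('n::finite \<Rightarrow> 'f) \<Rightarrow>
    (('n \<Rightarrow>\<^sub>0 int) \<Rightarrow>\<^sub>0 'r) \<Rightarrow> 'f" where
  "leval c v p = (\<Sum>m\<in>Poly_Mapping.keys p.
     c (Poly_Mapping.lookup p m) * (\<Prod>i\<in>UNIV. v i powi Poly_Mapping.lookup m i))"

definition laurent_of :: "'n::{finite,linorder} pol \<Rightarrow> 'n laurent" where
  "laurent_of p = peval const var p"

text \<open>
  Substitution into a Laurent polynomial, with values in the fraction field of the Laurent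
  polynomial ring.
\<close>

definition lsubst :: "('n::{finite,linorder} \<Rightarrow> 'n laurent fract) \<Rightarrow> 'n laurent \<Rightarrow> 'n laurent fract" where
  "lsubst v p = leval (\<lambda>r. to_fract (const r)) v p"

definition lvar :: "'n::{finite,linorder} \<Rightarrow> 'n laurent fract" where
  "lvar i = to_fract (var i)"

definition coeff_in_ratfun :: "'n::{finite,linorder} coeffs \<Rightarrow> 'n ratfun" where
  "coeff_in_ratfun r = to_fract (const (to_fract r))"

definition X :: "'n::{finite,linorder} \<Rightarrow> 'n ratfun" where
  "X i = to_fract (var i)"

definition A :: "'n::{finite,linorder} \<Rightarrow> 'n ratfun" where
  "A i = coeff_in_ratfun (var i)"

text \<open>
  A pair \<open>(x, F)\<close> consists of the cluster variables \<open>x i\<close> as elements of the ambient field and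
  of the exchange polynomials \<open>F i\<close> as formal polynomials, whose \<open>j\<close>-th variable stands for \<open>x j\<close>.
\<close>

type_synonym 'n seed_data = "('n \<Rightarrow> 'n ratfun) \<times> ('n \<Rightarrow> 'n pol)"

definition generating_transcendence_basis :: "('n::{finite,linorder} \<Rightarrow> 'n ratfun) \<Rightarrow> bool" where
  "generating_transcendence_basis x \<longleftrightarrow>
     (let ev = peval (\<lambda>r. to_fract (const r)) x
      in (\<forall>p. ev p = 0 \<longrightarrow> p = 0) \<and> (\<forall>f. \<exists>p q. ev q \<noteq> 0 \<and> f = ev p / ev q))"

definition seed :: "'n::{finite,linorder} seed_data \<Rightarrow> bool" where
  "seed S \<longleftrightarrow> (case S of (x, F) \<Rightarrow>
     generating_transcendence_basis x \<and>
     (\<forall>i. irreducible (F i) \<and> (\<forall>j. \<not> var j dvd F i) \<and> \<not> involves i (F i)))"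

text \<open>
  In \<open>is_hat\<close> the \<open>j\<close>-th variable is reused for the variable \<open>X\<close> of the substitution
  $X_j \leftarrow F_j / X$; this is harmless since \<open>F j\<close> does not involve it.
\<close>

definition is_hat :: "('n::{finite,linorder} \<Rightarrow> 'n pol) \<Rightarrow> 'n \<Rightarrow> 'n laurent \<Rightarrow> bool" where
  "is_hat F i L \<longleftrightarrow>
     (\<exists>a. Poly_Mapping.lookup a i = 0 \<and> (\<forall>j. Poly_Mapping.lookup a j \<le> 0) \<and>
          L = Poly_Mapping.single a 1 * laurent_of (F i)) \<and>
     (\<forall>j. j \<noteq> i \<longrightarrow>
        (\<exists>q. lsubst (lvar(j := to_fract (laurent_of (F j)) / lvar j)) L = to_fract q \<and>
             \<not> laurent_of (F j) dvd q))"

definition hat :: "('n::{finite,linorder} \<Rightarrow> 'n pol) \<Rightarrow> 'n \<Rightarrow> 'n laurent" where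
  "hat F i = (THE L. is_hat F i L)"

text \<open>
  \<open>divide_out i j C G H\<close>: \<open>H\<close> arises from \<open>G\<close> by successively dividing out common factors with
  \<open>C\<close> that are polynomials in the variables other than the \<open>i\<close>-th and \<open>j\<close>-th one.
\<close>

inductive divide_out ::
    "'n::{finite,linorder} \<Rightarrow> 'n \<Rightarrow> 'n laurent \<Rightarrow> 'n laurent \<Rightarrow> 'n laurent \<Rightarrow> bool"
  for i j :: 'n and C :: "'n laurent" where
  refl: "divide_out i j C G G"
| step: "\<not> involves i p \<Longrightarrow> \<not> involves j p \<Longrightarrow> laurent_of p dvd C \<Longrightarrow>
     divide_out i j C G H \<Longrightarrow> divide_out i j C (laurent_of p * G) H"

text \<open>
  The exchange polynomial \<open>P\<close> at \<open>j\<close> after mutation at \<open>i\<close>, when \<open>F j\<close> involves the \<open>i\<close>-th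
  variable; in \<open>G\<close>, \<open>H\<close> and \<open>P\<close> the \<open>i\<close>-th variable stands for the new cluster variable.
  Divisibility is that of the Laurent polynomial ring, in which monomials are units, so
  monomial factors never count as common factors; they are adjusted by \<open>m\<close> at the end.
  When \<open>F j\<close> involves the \<open>i\<close>-th variable, the exponent of the \<open>j\<close>-th variable in the
  monomial prefactor of \<open>hat F i\<close> is 0, so no negative power of 0 occurs in \<open>C\<close>.
\<close>

definition mutated_poly ::
    "('n::{finite,linorder} \<Rightarrow> 'n pol) \<Rightarrow> 'n \<Rightarrow> 'n \<Rightarrow> 'n pol \<Rightarrow> bool" where
  "mutated_poly F i j P \<longleftrightarrow>
     (\<exists>C G H m.
        to_fract C = lsubst (lvar(j := 0)) (hat F i) \<and>
        to_fract G = lsubst (lvar(i := to_fract C / lvar i)) (laurent_of (F j)) \<and>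
        divide_out i j C G H \<and>
        (\<forall>p. \<not> involves i p \<longrightarrow> \<not> involves j p \<longrightarrow>
             laurent_of p dvd C \<longrightarrow> laurent_of p dvd H \<longrightarrow> laurent_of p dvd 1) \<and>
        Poly_Mapping.lookup m j = 0 \<and>
        laurent_of P = Poly_Mapping.single m 1 * H \<and>
        (\<forall>l. \<not> var l dvd P))"

text \<open>
  Mutation is a relation because the new exchange polynomials are only determined up to units
  of the coefficient ring, that is, up to sign.
\<close>

definition mutation :: "'n::{finite,linorder} \<Rightarrow> 'n seed_data \<Rightarrow> 'n seed_data \<Rightarrow> bool" where
  "mutation i S S' \<longleftrightarrow> (case (S, S') of ((x, F), (x', F')) \<Rightarrow>
     seed (x', F') \<and>
     x' = x(i := leval coeff_in_ratfun x (hat F i) / x i) \<and>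
     (\<forall>j. if involves i (F j) then mutated_poly F i j (F' j) else F' j = F j))"

definition initial_seed :: "'n::{finite,linorder} seed_data" where
  "initial_seed = (X, \<lambda>i. const (var i) + (\<Prod>j\<in>UNIV - {i}. var j))"

text \<open>
  The polynomial fixing the sign of the exchange polynomial at \<open>\<sigma> \<notin> set s\<close> (for nonempty \<open>s\<close>):
  the variable with index \<open>last s\<close> stands for the cluster variable created last.
\<close>

definition reference_poly :: "'n::{finite,linorder} list \<Rightarrow> 'n \<Rightarrow> 'n pol" where
  "reference_poly s \<sigma> =
     (\<Prod>r\<in>set s. const (var r)) * (\<Prod>\<rho>\<in>UNIV - set s - {\<sigma>}. var \<rho>) + const (var \<sigma>) * var (last s)"

text \<open>
  \<open>tau s S\<close>: \<open>S\<close> is a seed obtained from the initial one by mutating successively at the entries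
  of \<open>s\<close>.  The sign convention only excludes the negative of the reference polynomial; that the
  exchange polynomial equals the reference polynomial up to sign is not assumed.
\<close>

inductive tau :: "'n::{finite,linorder} list \<Rightarrow> 'n seed_data \<Rightarrow> bool" where
  Nil: "tau [] initial_seed"
| snoc: "tau s S \<Longrightarrow> i \<notin> set s \<Longrightarrow> mutation i S S' \<Longrightarrow>
     (\<forall>\<sigma>. \<sigma> \<notin> set (s @ [i]) \<longrightarrow> snd S' \<sigma> \<noteq> - reference_poly (s @ [i]) \<sigma>) \<Longrightarrow>
     tau (s @ [i]) S'"

end

theory Submission
  imports Defs
begin

text \<open>
  After the mutations at \<open>s\<close> the exchange polynomial at $\sigma \notin s$ is
  $\prod_{r \in s} A_r \prod_{\rho \notin s, \rho \ne \sigma} X_\rho + A_\sigma Y_s$, so mutating at \<open>i\<close> gives the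
  recursion $X_i Y_{s i} = \prod_{r \in s} A_r \prod_{\rho \notin s, \rho \ne i} X_\rho + A_i Y_s$, which the
  claimed formula solves.  No Laurent monomial is needed in $\hat F_i$: at the indices $j \notin s$
  and at the last mutated one this is seen by evaluating at $A_j = -1$, all other indeterminates
  being 1; the exchange polynomials at the earlier indices do not contain $A_i$, whereas $F_i$ is
  linear in $A_i$ with leading coefficient a Laurent unit.  That linearity also makes $F_i$ a prime of the Laurent polynomial ring, and
  primality of the other exchange polynomials is transported by the substitution
  $X_i \leftarrow F_i / X_i$, an involution after inverting $F_i$; hence all mutations exist.
\<close>

section \<open>Evaluation homomorphisms\<close>

text \<open>At indices mutated before the last one the exchange polynomials have no convenient
  closed form, so the induction keeps about them only that \<open>A_\<tau>\<close> is absent for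
  every \<tau> not yet mutated. This survives dividing out common factors, because a divisor of a
  nonzero Laurent polynomial without \<open>A_\<tau>\<close> has no \<open>A_\<tau>\<close> either.
  At unmutated indices the closed form must hold for every admissible outcome of a mutation, which
  is a relation. There \<open>C\<close> is \<open>A_i\<close> times a unit and the prime
  \<open>A_i\<close> does not divide \<open>G\<close>: only units can be divided out, the outcome is
  determined up to sign, and the convention fixes the sign. So the formula is proved for every seed
  related by \<open>tau\<close>, while existence is a separate induction that exhibits one outcome
  per index. The existence proof carries primality in the Laurent polynomial ring: this passes
  through the localisation argument, and for a polynomial divisible by no variable it implies the
  irreducibility in the polynomial ring that a seed demands.\<close>

locale comm_ring_hom =
  fixes f :: "'a::comm_ring_1 \<Rightarrow> 'b::comm_ring_1"
  assumes hom_add: "f (x + y) = f x + f y"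
    and hom_mult: "f (x * y) = f x * f y"
    and hom_one: "f 1 = 1"
begin

lemma hom_zero: "f 0 = 0"
  using hom_add[of 0 0] by simp

lemma hom_uminus: "f (- x) = - f x"
  using hom_add[of x "- x"] by (simp add: hom_zero eq_neg_iff_add_eq_0 add.commute)

lemma hom_diff: "f (x - y) = f x - f y"
  using hom_add[of x "- y"] by (simp add: hom_uminus)

lemma hom_sum: "f (\<Sum>i\<in>I. g i) = (\<Sum>i\<in>I. f (g i))"
  by (induction I rule: infinite_finite_induct) (simp_all add: hom_zero hom_add)

lemma hom_prod: "f (\<Prod>i\<in>I. g i) = (\<Prod>i\<in>I. f (g i))"
  by (induction I rule: infinite_finite_induct) (simp_all add: hom_one hom_mult)

lemma hom_power: "f (x ^ k) = f x ^ k"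
  by (induction k) (simp_all add: hom_one hom_mult)

lemma hom_of_int: "f (of_int k) = of_int k"
proof -
  have "f (of_nat n) = of_nat n" for n
    by (induction n) (simp_all add: hom_zero hom_one hom_add)
  then show ?thesis
    by (cases k rule: int_cases2) (simp_all add: hom_uminus)
qed

lemma hom_dvd: "x dvd y \<Longrightarrow> f x dvd f y"
  by (auto simp: dvd_def hom_mult)

lemmas hom_simps = hom_zero hom_one hom_add hom_mult hom_uminus hom_diff hom_sum hom_prod hom_power

end

lemma comm_ring_hom_comp:
  "comm_ring_hom f \<Longrightarrow> comm_ring_hom g \<Longrightarrow> comm_ring_hom (\<lambda>x. f (g x))"
  by (simp add: comm_ring_hom_def)

lemma comm_ring_hom_id: "comm_ring_hom (\<lambda>x. x)"
  by (simp add: comm_ring_hom_def)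

lemma comm_ring_hom_to_fract: "comm_ring_hom to_fract"
  by (simp add: comm_ring_hom_def)

lemma comm_ring_hom_of_int: "comm_ring_hom of_int"
  by (simp add: comm_ring_hom_def)

lemma comm_ring_hom_const:
  "comm_ring_hom (const :: 'r::comm_ring_1 \<Rightarrow> ('n \<Rightarrow>\<^sub>0 'e::comm_monoid_add) \<Rightarrow>\<^sub>0 'r)"
  by (simp add: comm_ring_hom_def const_def single_add mult_single)

lemmas const_simps = comm_ring_hom.hom_simps[OF comm_ring_hom_const]
lemmas to_fract_simps = comm_ring_hom.hom_simps[OF comm_ring_hom_to_fract]

section \<open>Evaluation of finitely supported maps\<close>

lemma pm_eq_sum_single: "p = (\<Sum>m\<in>Poly_Mapping.keys p. Poly_Mapping.single m (Poly_Mapping.lookup p m))"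
proof (rule poly_mapping_eqI)
  fix k
  have "(\<Sum>m\<in>Poly_Mapping.keys p. Poly_Mapping.lookup (Poly_Mapping.single m (Poly_Mapping.lookup p m)) k)
      = (\<Sum>m\<in>Poly_Mapping.keys p. if m = k then Poly_Mapping.lookup p k else 0)"
    by (intro sum.cong) (auto simp: lookup_single)
  then show "Poly_Mapping.lookup p k = Poly_Mapping.lookup
      (\<Sum>m\<in>Poly_Mapping.keys p. Poly_Mapping.single m (Poly_Mapping.lookup p m)) k"
    by (auto simp: lookup_sum sum.delta in_keys_iff)
qed

lemma pm_induct [case_names single add]:
  fixes p :: "'k \<Rightarrow>\<^sub>0 'r::comm_monoid_add"
  assumes "\<And>m r. P (Poly_Mapping.single m r)" "\<And>p q. P p \<Longrightarrow> P q \<Longrightarrow> P (p + q)"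
  shows "P p"
proof -
  have "P (\<Sum>m\<in>S. Poly_Mapping.single m (g m))" if "finite S" for S and g :: "'k \<Rightarrow> 'r"
    \<comment> \<open>The empty sum is a \<open>single\<close> with coefficient 0, at an arbitrary
      key.\<close>
    using that assms(1)[of undefined 0] by (induction S rule: finite_induct) (auto intro: assms)
  then show ?thesis
    using pm_eq_sum_single[of p] by (metis finite_keys)
qed

text \<open>\<open>peval\<close> and \<open>leval\<close> differ only in how a monomial is
  evaluated. Leaving \<mu> arbitrary lets one homomorphism proof serve both of them and the
  coefficient changes \<open>valA\<close> and \<open>subA\<close> below.\<close>

definition mev :: "('r::zero \<Rightarrow> 's::comm_semiring_1) \<Rightarrow> ('k \<Rightarrow> 's) \<Rightarrow> ('k \<Rightarrow>\<^sub>0 'r) \<Rightarrow> 's" where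
  "mev c \<mu> p = (\<Sum>m\<in>Poly_Mapping.keys p. c (Poly_Mapping.lookup p m) * \<mu> m)"

lemma mev_superset:
  assumes "finite S" "Poly_Mapping.keys p \<subseteq> S" "c 0 = 0"
  shows "mev c \<mu> p = (\<Sum>m\<in>S. c (Poly_Mapping.lookup p m) * \<mu> m)"
  unfolding mev_def using assms by (intro sum.mono_neutral_left) (auto simp: in_keys_iff)

lemma mev_single: "c 0 = 0 \<Longrightarrow> mev c \<mu> (Poly_Mapping.single m r) = c r * \<mu> m"
  by (subst mev_superset[where S = "{m}"]) (auto simp: lookup_single)

lemma mev_add:
  assumes "comm_ring_hom c"
  shows "mev c \<mu> (p + q) = mev c \<mu> p + mev c \<mu> q"
proof -
  interpret comm_ring_hom c by fact
  let ?S = "Poly_Mapping.keys p \<union> Poly_Mapping.keys q"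
  have "mev c \<mu> r = (\<Sum>m\<in>?S. c (Poly_Mapping.lookup r m) * \<mu> m)"
    if "Poly_Mapping.keys r \<subseteq> ?S" for r
    by (rule mev_superset) (use that hom_zero in auto)
  then show ?thesis
    using keys_add[of p q] by (simp add: lookup_add hom_add distrib_right sum.distrib)
qed

lemma comm_ring_hom_mev:
  fixes \<mu> :: "'k::comm_monoid_add \<Rightarrow> 's::comm_ring_1"
  assumes "comm_ring_hom c" "\<mu> 0 = 1" "\<And>a b. \<mu> (a + b) = \<mu> a * \<mu> b"
  shows "comm_ring_hom (mev c \<mu>)"
proof -
  interpret comm_ring_hom c by fact
  have "mev c \<mu> (p * q) = mev c \<mu> p * mev c \<mu> q" for p q
  proof (induction p rule: pm_induct)
    case (single m r)
    show ?case
    proof (induction q rule: pm_induct)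
      case (single m' r')
      then show ?case by (simp add: mult_single mev_single hom_zero hom_mult assms(3) ac_simps)
    qed (simp add: distrib_left mev_add[OF assms(1)])
  qed (simp add: distrib_right mev_add[OF assms(1)])
  moreover have "mev c \<mu> 1 = 1"
    using mev_single[of c \<mu> 0 1] by (simp add: hom_zero hom_one assms(2))
  ultimately show ?thesis
    by (simp add: comm_ring_hom_def mev_add[OF assms(1)])
qed

lemma peval_eq_mev: "peval c v = mev c (\<lambda>m. \<Prod>i\<in>UNIV. v i ^ Poly_Mapping.lookup m i)"
  by (simp add: fun_eq_iff peval_def mev_def)

lemma leval_eq_mev: "leval c v = mev c (\<lambda>m. \<Prod>i\<in>UNIV. v i powi Poly_Mapping.lookup m i)"
  by (simp add: fun_eq_iff leval_def mev_def)

lemma comm_ring_hom_peval: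
  fixes v :: "'n::finite \<Rightarrow> 's::comm_ring_1"
  assumes "comm_ring_hom c"
  shows "comm_ring_hom (peval c v)"
  unfolding peval_eq_mev
  by (rule comm_ring_hom_mev) (simp_all add: assms lookup_add power_add prod.distrib)

lemma comm_ring_hom_leval:
  fixes v :: "'n::finite \<Rightarrow> 's::field"
  assumes "comm_ring_hom c" "\<And>i. v i \<noteq> 0"
  shows "comm_ring_hom (leval c v)"
  unfolding leval_eq_mev
  by (rule comm_ring_hom_mev) (simp_all add: assms lookup_add power_int_add prod.distrib)

lemma prod_single_power:
  fixes v :: "'n::finite \<Rightarrow> 's::comm_monoid_mult"
  shows "(\<Prod>j\<in>UNIV. v j ^ Poly_Mapping.lookup (Poly_Mapping.single i k) j) = v i ^ k"
proof -
  have "(\<Prod>j\<in>UNIV. v j ^ Poly_Mapping.lookup (Poly_Mapping.single i k) j) = (\<Prod>j\<in>UNIV. if j = i then v i ^ k else 1)"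
    by (intro prod.cong) (auto simp: lookup_single when_def)
  then show ?thesis by simp
qed

lemma prod_single_powi:
  fixes v :: "'n::finite \<Rightarrow> 's::field"
  shows "(\<Prod>j\<in>UNIV. v j powi Poly_Mapping.lookup (Poly_Mapping.single i k) j) = v i powi k"
proof -
  have "(\<Prod>j\<in>UNIV. v j powi Poly_Mapping.lookup (Poly_Mapping.single i k) j) = (\<Prod>j\<in>UNIV. if j = i then v i powi k else 1)"
    by (intro prod.cong) (auto simp: lookup_single when_def)
  then show ?thesis by simp
qed

lemma peval_const:
  assumes "comm_ring_hom c" shows "peval c v (const r) = c r"
  by (simp add: peval_eq_mev const_def mev_single comm_ring_hom.hom_zero[OF assms])

lemma peval_var:
  assumes "comm_ring_hom c" shows "peval c v (var i) = v i"
  by (simp add: peval_eq_mev var_def mev_single comm_ring_hom.hom_simps[OF assms] prod_single_power)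

lemma leval_const:
  assumes "comm_ring_hom c" shows "leval c v (const r) = c r"
  by (simp add: leval_eq_mev const_def mev_single comm_ring_hom.hom_zero[OF assms])

lemma leval_var:
  assumes "comm_ring_hom c" shows "leval c v (var i) = v i"
  using prod_single_powi[of v i 1]
  by (simp add: leval_eq_mev var_def mev_single comm_ring_hom.hom_simps[OF assms])

section \<open>Generators\<close>

definition ivar :: "'n \<Rightarrow> ('n \<Rightarrow>\<^sub>0 int) \<Rightarrow>\<^sub>0 'r::comm_ring_1" where
  "ivar i = Poly_Mapping.single (Poly_Mapping.single i (- 1)) 1"

lemma var_ivar: "var i * ivar i = 1"
  by (simp add: var_def ivar_def mult_single flip: single_add)

lemma laurent_var_unit: "(var l :: ('n \<Rightarrow>\<^sub>0 int) \<Rightarrow>\<^sub>0 'r::comm_ring_1) dvd 1"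
  by (metis dvd_triv_left var_ivar)

lemma laurent_ivar_unit: "(ivar l :: ('n \<Rightarrow>\<^sub>0 int) \<Rightarrow>\<^sub>0 'r::comm_ring_1) dvd 1"
  by (metis dvd_triv_right var_ivar)

lemma laurent_var_nonzero: "(var l :: ('n \<Rightarrow>\<^sub>0 int) \<Rightarrow>\<^sub>0 'r::comm_ring_1) \<noteq> 0"
  by (metis mult_zero_left var_ivar zero_neq_one)

lemma single_eq_const_mult: "Poly_Mapping.single m r = const r * Poly_Mapping.single m (1::'r::comm_ring_1)"
  for m :: "'n \<Rightarrow>\<^sub>0 'e::comm_monoid_add"
  by (simp add: const_def mult_single)

lemma exponent_eq_sum: "m = (\<Sum>i\<in>UNIV. Poly_Mapping.single i (Poly_Mapping.lookup m i))"
  for m :: "'n::finite \<Rightarrow>\<^sub>0 'e::comm_monoid_add"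
proof -
  have "(\<Sum>i\<in>Poly_Mapping.keys m. Poly_Mapping.single i (Poly_Mapping.lookup m i))
      = (\<Sum>i\<in>UNIV. Poly_Mapping.single i (Poly_Mapping.lookup m i))"
    by (intro sum.mono_neutral_left) (auto simp: in_keys_iff)
  then show ?thesis using pm_eq_sum_single[of m] by simp
qed

lemma single_sum_exponents:
  "Poly_Mapping.single (\<Sum>i\<in>I. e i) 1 = (\<Prod>i\<in>I. Poly_Mapping.single (e i) (1::'r::comm_ring_1))"
  for e :: "'i \<Rightarrow> 'k::comm_monoid_add"
proof (induction I rule: infinite_finite_induct)
  case (insert x F)
  have "Poly_Mapping.single (e x + sum e F) (1::'r) = Poly_Mapping.single (e x) 1 * Poly_Mapping.single (sum e F) 1"
    by (simp add: mult_single)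
  then show ?case using insert by simp
qed simp_all

lemma monomial_eq_prod:
  "Poly_Mapping.single m (1::'r::comm_ring_1) = (\<Prod>i\<in>UNIV. Poly_Mapping.single (Poly_Mapping.single i (Poly_Mapping.lookup m i)) 1)"
  for m :: "'n::finite \<Rightarrow>\<^sub>0 'e::comm_monoid_add"
  by (subst exponent_eq_sum[of m]) (rule single_sum_exponents)

lemma var_power: "var i ^ k = Poly_Mapping.single (Poly_Mapping.single i (of_nat k)) (1::'r::comm_ring_1)"
  for i :: 'n
  by (induction k) (simp_all add: var_def mult_single flip: single_add)

lemma ivar_power: "ivar i ^ k = Poly_Mapping.single (Poly_Mapping.single i (- int k)) (1::'r::comm_ring_1)"
  by (induction k) (simp_all add: ivar_def mult_single flip: single_add)

lemma pol_induct [case_names const var add mult]: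
  fixes p :: "('n::finite \<Rightarrow>\<^sub>0 nat) \<Rightarrow>\<^sub>0 'r::comm_ring_1"
  assumes const: "\<And>r. P (const r)" and var: "\<And>i. P (var i)"
    and add: "\<And>p q. P p \<Longrightarrow> P q \<Longrightarrow> P (p + q)" and mult: "\<And>p q. P p \<Longrightarrow> P q \<Longrightarrow> P (p * q)"
  shows "P p"
proof (induction p rule: pm_induct)
  case (single m r)
  have one: "P 1" using const[of 1] by (simp add: const_simps)
  have pow: "P (q ^ k)" if "P q" for q k
    using that by (induction k) (auto intro: one mult)
  have "P (\<Prod>i\<in>I. Poly_Mapping.single (Poly_Mapping.single i (Poly_Mapping.lookup m i)) 1)" for I
  proof (induction I rule: infinite_finite_induct)
    case (insert x F)
    then show ?case
      using pow[OF var[of x], of "Poly_Mapping.lookup m x"] by (simp add: var_power mult)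
  qed (simp_all add: one)
  then have "P (Poly_Mapping.single m 1)" by (subst monomial_eq_prod)
  then show ?case by (subst single_eq_const_mult) (intro mult const)
qed (rule add)

lemma laurent_induct [case_names const var ivar add mult]:
  fixes p :: "('n::finite \<Rightarrow>\<^sub>0 int) \<Rightarrow>\<^sub>0 'r::comm_ring_1"
  assumes const: "\<And>r. P (const r)" and var: "\<And>i. P (var i)" and ivar: "\<And>i. P (ivar i)"
    and add: "\<And>p q. P p \<Longrightarrow> P q \<Longrightarrow> P (p + q)" and mult: "\<And>p q. P p \<Longrightarrow> P q \<Longrightarrow> P (p * q)"
  shows "P p"
proof (induction p rule: pm_induct)
  case (single m r)
  have one: "P 1" using const[of 1] by (simp add: const_simps)
  have pow: "P (q ^ k)" if "P q" for q k
    using that by (induction k) (auto intro: one mult)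
  have "P (Poly_Mapping.single (Poly_Mapping.single i k) 1)" for i k
  proof (cases "k \<ge> 0")
    case True
    then show ?thesis using pow[OF var[of i], of "nat k"] by (simp add: var_power)
  next
    case False
    then show ?thesis using pow[OF ivar[of i], of "nat (- k)"] by (simp add: ivar_power)
  qed
  then have "P (\<Prod>i\<in>I. Poly_Mapping.single (Poly_Mapping.single i (Poly_Mapping.lookup m i)) 1)" for I
    by (induction I rule: infinite_finite_induct) (auto simp: one intro: mult)
  then have "P (Poly_Mapping.single m 1)" by (subst monomial_eq_prod)
  then show ?case by (subst single_eq_const_mult) (intro mult const)
qed (rule add)

text \<open>Integer constants appear as \<open>of_int\<close> because every ring homomorphism fixes
  these. A homomorphism out of the coefficient ring is thus determined by the images of the
  variables.\<close>

lemma coeffs_induct [case_names of_int var add mult]: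
  fixes p :: "('n::finite \<Rightarrow>\<^sub>0 nat) \<Rightarrow>\<^sub>0 int"
  assumes "\<And>k. P (of_int k)" "\<And>i. P (var i)"
    "\<And>p q. P p \<Longrightarrow> P q \<Longrightarrow> P (p + q)" "\<And>p q. P p \<Longrightarrow> P q \<Longrightarrow> P (p * q)"
  shows "P p"
proof (induction p rule: pol_induct)
  case (const r)
  have "Poly_Mapping.single 0 (of_int r) = (of_int r :: ('n \<Rightarrow>\<^sub>0 nat) \<Rightarrow>\<^sub>0 int)"
    by (rule single_of_int)
  then have "const r = (of_int r :: ('n \<Rightarrow>\<^sub>0 nat) \<Rightarrow>\<^sub>0 int)"
    by (simp only: const_def of_int_eq_id id_apply)
  then show ?case using assms(1)[of r] by (simp only:)
qed (use assms in auto)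

lemma pol_hom_eqI:
  fixes f :: "(('n::finite \<Rightarrow>\<^sub>0 nat) \<Rightarrow>\<^sub>0 'r::comm_ring_1) \<Rightarrow> 's::comm_ring_1"
  assumes "comm_ring_hom f" "comm_ring_hom g"
    "\<And>r. f (const r) = g (const r)" "\<And>i. f (var i) = g (var i)"
  shows "f p = g p"
  by (induction p rule: pol_induct) (simp_all add: assms comm_ring_hom.hom_simps[OF assms(1)] comm_ring_hom.hom_simps[OF assms(2)])

lemma coeffs_hom_eqI:
  fixes f :: "(('n::finite \<Rightarrow>\<^sub>0 nat) \<Rightarrow>\<^sub>0 int) \<Rightarrow> 's::comm_ring_1"
  assumes "comm_ring_hom f" "comm_ring_hom g" "\<And>i. f (var i) = g (var i)"
  shows "f p = g p"
proof (induction p rule: coeffs_induct)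
  case (of_int k)
  show ?case by (simp only: comm_ring_hom.hom_of_int[OF assms(1)] comm_ring_hom.hom_of_int[OF assms(2)])
qed (simp_all add: assms comm_ring_hom.hom_simps[OF assms(1)] comm_ring_hom.hom_simps[OF assms(2)])

text \<open>Agreement at the inverse variables follows from agreement at the variables, since
  inverses in a commutative ring are unique.\<close>

lemma laurent_hom_eqI:
  fixes f :: "(('n::finite \<Rightarrow>\<^sub>0 int) \<Rightarrow>\<^sub>0 'r::comm_ring_1) \<Rightarrow> 's::comm_ring_1"
  assumes f: "comm_ring_hom f" and g: "comm_ring_hom g"
    and "\<And>r. f (const r) = g (const r)" "\<And>i. f (var i) = g (var i)"
  shows "f p = g p"
proof (induction p rule: laurent_induct)
  case (ivar i)
  have "h (var i) * h (ivar i) = 1" if "comm_ring_hom h" for h :: "(('n \<Rightarrow>\<^sub>0 int) \<Rightarrow>\<^sub>0 'r) \<Rightarrow> 's"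
    using that by (metis comm_ring_hom.hom_mult comm_ring_hom.hom_one var_ivar)
  note inv = this[OF f] this[OF g]
  have "f (ivar i) = f (ivar i) * (g (var i) * g (ivar i))" by (simp add: inv(2))
  also have "\<dots> = (f (var i) * f (ivar i)) * g (ivar i)" by (simp add: assms(4) ac_simps)
  finally show ?case by (simp add: inv(1))
qed (simp_all add: assms comm_ring_hom.hom_simps[OF assms(1)] comm_ring_hom.hom_simps[OF assms(2)])

section \<open>Polynomials as Laurent polynomials\<close>

definition int_exp :: "('n \<Rightarrow>\<^sub>0 nat) \<Rightarrow> ('n \<Rightarrow>\<^sub>0 int)" where
  "int_exp = Poly_Mapping.map int"

lemma lookup_int_exp [simp]: "Poly_Mapping.lookup (int_exp m) i = int (Poly_Mapping.lookup m i)"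
  by (simp add: int_exp_def map.rep_eq when_def)

lemma int_exp_inject [simp]: "int_exp m = int_exp m' \<longleftrightarrow> m = m'"
  by (auto simp: poly_mapping_eq_iff fun_eq_iff)

lemma int_exp_surj:
  assumes "\<And>i. Poly_Mapping.lookup k i \<ge> 0"
  obtains m where "int_exp m = k"
proof
  show "int_exp (Poly_Mapping.map nat k) = k"
    using assms by (intro poly_mapping_eqI) (simp add: map.rep_eq when_def)
qed

lemma var_prod_eq_single:
  "(\<Prod>i\<in>UNIV. var i ^ Poly_Mapping.lookup m i) = Poly_Mapping.single (int_exp m) (1::'r::comm_ring_1)"
  for m :: "'n::finite \<Rightarrow>\<^sub>0 nat"
  by (subst monomial_eq_prod) (simp add: var_power)

lemma laurent_of_eq_mev: "laurent_of = mev const (\<lambda>m. Poly_Mapping.single (int_exp m) 1)"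
  by (simp add: fun_eq_iff laurent_of_def peval_eq_mev var_prod_eq_single)

lemma comm_ring_hom_laurent_of: "comm_ring_hom laurent_of"
  unfolding laurent_of_def by (intro comm_ring_hom_peval comm_ring_hom_const)

lemmas laurent_of_simps = comm_ring_hom.hom_simps[OF comm_ring_hom_laurent_of]

lemma laurent_of_const [simp]: "laurent_of (const r) = const r"
  by (simp add: laurent_of_def peval_const comm_ring_hom_const)

lemma laurent_of_var [simp]: "laurent_of (var i) = var i"
  by (simp add: laurent_of_def peval_var comm_ring_hom_const)

lemma laurent_of_single: "laurent_of (Poly_Mapping.single m r) = Poly_Mapping.single (int_exp m) r"
  unfolding laurent_of_eq_mev
  by (subst mev_single) (simp_all add: const_simps flip: single_eq_const_mult)

lemma laurent_of_eq_sum: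
  "laurent_of p = (\<Sum>m\<in>Poly_Mapping.keys p. Poly_Mapping.single (int_exp m) (Poly_Mapping.lookup p m))"
  by (simp add: laurent_of_eq_mev mev_def flip: single_eq_const_mult)

lemma lookup_laurent_of: "Poly_Mapping.lookup (laurent_of p) (int_exp m) = Poly_Mapping.lookup p m"
proof -
  have "Poly_Mapping.lookup (laurent_of p) (int_exp m)
      = (\<Sum>k\<in>Poly_Mapping.keys p. if k = m then Poly_Mapping.lookup p m else 0)"
    unfolding laurent_of_eq_sum lookup_sum by (intro sum.cong) (auto simp: lookup_single)
  then show ?thesis by (auto simp: sum.delta in_keys_iff)
qed

lemma keys_laurent_of: "Poly_Mapping.keys (laurent_of p) = int_exp ` Poly_Mapping.keys p"
proof
  show "Poly_Mapping.keys (laurent_of p) \<subseteq> int_exp ` Poly_Mapping.keys p"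
    unfolding laurent_of_eq_sum by (rule order_trans[OF keys_sum]) (auto split: if_splits)
qed (auto simp: in_keys_iff lookup_laurent_of)

lemma laurent_of_inject [simp]: "laurent_of p = laurent_of q \<longleftrightarrow> p = q"
  by (metis lookup_laurent_of poly_mapping_eqI)

lemma laurent_of_eq_0_iff [simp]: "laurent_of p = 0 \<longleftrightarrow> p = 0"
  using laurent_of_inject[of p 0] by (simp add: laurent_of_simps del: laurent_of_inject)

lemma involves_laurent_of [simp]: "involves i (laurent_of p) \<longleftrightarrow> involves i p"
  by (auto simp: involves_def keys_laurent_of)

lemma laurent_of_surj:
  assumes "\<And>k i. k \<in> Poly_Mapping.keys L \<Longrightarrow> Poly_Mapping.lookup k i \<ge> 0"
  obtains p where "laurent_of p = L"
proof -
  have "\<forall>k\<in>Poly_Mapping.keys L. \<exists>m. int_exp m = k"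
    using assms int_exp_surj by metis
  then obtain g where g: "\<And>k. k \<in> Poly_Mapping.keys L \<Longrightarrow> int_exp (g k) = k" by metis
  have "laurent_of (\<Sum>k\<in>Poly_Mapping.keys L. Poly_Mapping.single (g k) (Poly_Mapping.lookup L k))
      = (\<Sum>k\<in>Poly_Mapping.keys L. Poly_Mapping.single k (Poly_Mapping.lookup L k))"
    by (simp add: laurent_of_simps laurent_of_single g)
  then show ?thesis using that pm_eq_sum_single[of L] by metis
qed

lemma hom_peval:
  assumes "comm_ring_hom f"
  shows "f (peval c v p) = peval (\<lambda>r. f (c r)) (\<lambda>i. f (v i)) p"
  by (simp add: peval_def comm_ring_hom.hom_simps[OF assms])

lemma leval_laurent_of: "leval c v (laurent_of p) = peval c v p"
  by (simp add: leval_def peval_def keys_laurent_of sum.reindex inj_on_def lookup_laurent_of)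

lemma lsubst_laurent_of: "lsubst v (laurent_of p) = peval (\<lambda>r. to_fract (const r)) v p"
  by (simp add: lsubst_def leval_laurent_of)

section \<open>Monomials and units\<close>

lemma lookup_single_mult:
  fixes p :: "'k::cancel_comm_monoid_add \<Rightarrow>\<^sub>0 'r::comm_ring_1"
  shows "Poly_Mapping.lookup (Poly_Mapping.single m c * p) (m + k) = c * Poly_Mapping.lookup p k"
  by (induction p rule: pm_induct) (auto simp: mult_single lookup_single when_def distrib_left lookup_add)

lemma keys_single_mult:
  fixes p :: "'k::cancel_comm_monoid_add \<Rightarrow>\<^sub>0 'r::idom"
  assumes "c \<noteq> 0"
  shows "Poly_Mapping.keys (Poly_Mapping.single m c * p) = (+) m ` Poly_Mapping.keys p"
proof
  show "Poly_Mapping.keys (Poly_Mapping.single m c * p) \<subseteq> (+) m ` Poly_Mapping.keys p"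
    using keys_mult[of "Poly_Mapping.single m c" p] assms by auto
  show "(+) m ` Poly_Mapping.keys p \<subseteq> Poly_Mapping.keys (Poly_Mapping.single m c * p)"
    using assms by (auto simp: in_keys_iff lookup_single_mult)
qed

lemma var_dvd_iff:
  fixes p :: "('n \<Rightarrow>\<^sub>0 nat) \<Rightarrow>\<^sub>0 'r::idom"
  shows "var l dvd p \<longleftrightarrow> (\<forall>m\<in>Poly_Mapping.keys p. Poly_Mapping.lookup m l \<ge> 1)"
proof
  assume "var l dvd p"
  then obtain q where "p = var l * q" by (auto simp: dvd_def)
  then show "\<forall>m\<in>Poly_Mapping.keys p. Poly_Mapping.lookup m l \<ge> 1"
    by (auto simp: var_def keys_single_mult lookup_add)
next
  assume *: "\<forall>m\<in>Poly_Mapping.keys p. Poly_Mapping.lookup m l \<ge> 1"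
  have "var l dvd (\<Sum>m\<in>Poly_Mapping.keys p. Poly_Mapping.single m (Poly_Mapping.lookup p m))"
  proof (rule dvd_sum)
    fix m assume m: "m \<in> Poly_Mapping.keys p"
    have "m = Poly_Mapping.single l 1 + (m - Poly_Mapping.single l 1)"
      using * m by (intro poly_mapping_eqI) (auto simp: lookup_add lookup_minus lookup_single when_def)
    then have "Poly_Mapping.single m (Poly_Mapping.lookup p m)
        = var l * Poly_Mapping.single (m - Poly_Mapping.single l 1) (Poly_Mapping.lookup p m)"
      by (simp add: var_def mult_single)
    then show "var l dvd Poly_Mapping.single m (Poly_Mapping.lookup p m)" by simp
  qed
  then show "var l dvd p" using pm_eq_sum_single[of p] by simp
qed

text \<open>Meant for extremal exponents: only one pair of terms contributes there, so no
  cancellation can occur.\<close>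

lemma lookup_mult_unique_pair:
  fixes p q :: "'k::comm_monoid_add \<Rightarrow>\<^sub>0 'r::comm_ring_1"
  assumes "a \<in> Poly_Mapping.keys p" "b \<in> Poly_Mapping.keys q"
    "\<And>a' b'. a' \<in> Poly_Mapping.keys p \<Longrightarrow> b' \<in> Poly_Mapping.keys q \<Longrightarrow> a' + b' = a + b \<Longrightarrow> a' = a \<and> b' = b"
  shows "Poly_Mapping.lookup (p * q) (a + b) = Poly_Mapping.lookup p a * Poly_Mapping.lookup q b"
proof -
  have "p * q = (\<Sum>a\<in>Poly_Mapping.keys p. Poly_Mapping.single a (Poly_Mapping.lookup p a))
      * (\<Sum>b\<in>Poly_Mapping.keys q. Poly_Mapping.single b (Poly_Mapping.lookup q b))"
    using pm_eq_sum_single[of p] pm_eq_sum_single[of q] by simp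
  also have "\<dots> = (\<Sum>x\<in>Poly_Mapping.keys p \<times> Poly_Mapping.keys q.
      Poly_Mapping.single (fst x + snd x) (Poly_Mapping.lookup p (fst x) * Poly_Mapping.lookup q (snd x)))"
    by (simp add: sum_product mult_single sum.cartesian_product case_prod_beta)
  finally have "Poly_Mapping.lookup (p * q) (a + b) = (\<Sum>x\<in>Poly_Mapping.keys p \<times> Poly_Mapping.keys q.
      Poly_Mapping.lookup (Poly_Mapping.single (fst x + snd x)
        (Poly_Mapping.lookup p (fst x) * Poly_Mapping.lookup q (snd x))) (a + b))"
    by (simp add: lookup_sum)
  also have "\<dots> = (\<Sum>x\<in>Poly_Mapping.keys p \<times> Poly_Mapping.keys q.
      if x = (a, b) then Poly_Mapping.lookup p a * Poly_Mapping.lookup q b else 0)"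
    by (intro sum.cong) (use assms(3) in \<open>auto simp: lookup_single when_def\<close>)
  finally show ?thesis using assms(1,2) by (simp add: sum.delta)
qed

text \<open>The largest exponents of the factors add up to an exponent of the product, and so do the
  smallest ones. As the product is 1, both sums are 0; hence in each factor the largest and the
  smallest exponent coincide.\<close>

lemma unit_pm_monomial:
  fixes p q :: "'k::{ordered_cancel_comm_monoid_add,linorder} \<Rightarrow>\<^sub>0 'r::idom"
  assumes "p * q = 1"
  obtains m c m' c' where "p = Poly_Mapping.single m c" "q = Poly_Mapping.single m' c'" "m + m' = 0" "c * c' = 1"
proof -
  have ne: "Poly_Mapping.keys p \<noteq> {}" "Poly_Mapping.keys q \<noteq> {}"
    using assms by auto
  define a b a' b' where "a = Max (Poly_Mapping.keys p)" and "b = Max (Poly_Mapping.keys q)"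
    and "a' = Min (Poly_Mapping.keys p)" and "b' = Min (Poly_Mapping.keys q)"
  have in_keys: "a \<in> Poly_Mapping.keys p" "b \<in> Poly_Mapping.keys q" "a' \<in> Poly_Mapping.keys p" "b' \<in> Poly_Mapping.keys q"
    using ne by (auto simp: a_def b_def a'_def b'_def)
  have bounds: "a' \<le> x" "x \<le> a" if "x \<in> Poly_Mapping.keys p" for x
    using that by (auto simp: a_def a'_def)
  have bounds': "b' \<le> x" "x \<le> b" if "x \<in> Poly_Mapping.keys q" for x
    using that by (auto simp: b_def b'_def)
  have eqI: "x = y \<and> z = w" if "x + z = y + w" "x \<le> y" "z \<le> w" for x y z w :: 'k
    using that add_less_le_mono[of x y z w] add_le_less_mono[of x y z w] by (auto simp: less_le)
  have prod_ab: "Poly_Mapping.lookup (p * q) (a + b) = Poly_Mapping.lookup p a * Poly_Mapping.lookup q b"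
  proof (rule lookup_mult_unique_pair)
    fix x y assume "x \<in> Poly_Mapping.keys p" "y \<in> Poly_Mapping.keys q" "x + y = a + b"
    then show "x = a \<and> y = b" using eqI[of x y a b] bounds(2)[of x] bounds'(2)[of y] by blast
  qed (use in_keys in auto)
  then have "Poly_Mapping.lookup (p * q) (a + b) \<noteq> 0" using in_keys by (simp add: in_keys_iff)
  then have ab: "a + b = 0" by (simp add: assms lookup_one when_def split: if_splits)
  have "Poly_Mapping.lookup (p * q) (a' + b') = Poly_Mapping.lookup p a' * Poly_Mapping.lookup q b'"
  proof (rule lookup_mult_unique_pair)
    fix x y assume "x \<in> Poly_Mapping.keys p" "y \<in> Poly_Mapping.keys q" "x + y = a' + b'"
    then show "x = a' \<and> y = b'" using eqI[of a' b' x y] bounds(1)[of x] bounds'(1)[of y] by metis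
  qed (use in_keys in auto)
  then have "Poly_Mapping.lookup (p * q) (a' + b') \<noteq> 0" using in_keys by (simp add: in_keys_iff)
  then have "a' + b' = 0" by (simp add: assms lookup_one when_def split: if_splits)
  then have eq: "a' = a" "b' = b"
    using eqI[of a' b' a b] ab bounds(2)[OF in_keys(3)] bounds'(2)[OF in_keys(4)] by metis+
  have "Poly_Mapping.keys p = {a}" "Poly_Mapping.keys q = {b}"
    using bounds bounds' in_keys eq by (auto intro: antisym)
  then have single: "p = Poly_Mapping.single a (Poly_Mapping.lookup p a)"
      "q = Poly_Mapping.single b (Poly_Mapping.lookup q b)"
    using pm_eq_sum_single[of p] pm_eq_sum_single[of q] by auto
  have "Poly_Mapping.lookup p a * Poly_Mapping.lookup q b = 1"
    using prod_ab ab by (simp add: assms)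
  then show ?thesis by (rule that[OF single ab])
qed

lemma laurent_unit_monomial: "(Poly_Mapping.single m 1 :: ('n \<Rightarrow>\<^sub>0 int) \<Rightarrow>\<^sub>0 'r::comm_ring_1) * Poly_Mapping.single (- m) 1 = 1"
  by (simp add: mult_single)

lemma laurent_monomial_unit: "(Poly_Mapping.single m 1 :: ('n \<Rightarrow>\<^sub>0 int) \<Rightarrow>\<^sub>0 'r::comm_ring_1) dvd 1"
  using laurent_unit_monomial by (metis dvd_triv_left)

lemma laurent_unitE:
  fixes p :: "'n::{finite,linorder} laurent"
  assumes "p dvd 1"
  obtains m c where "p = Poly_Mapping.single m c" "c dvd 1"
proof -
  from assms obtain q where "p * q = 1" by (auto simp: dvd_def)
  then obtain m c m' c' where "p = Poly_Mapping.single m c" "c * c' = 1" by (rule unit_pm_monomial)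
  then show ?thesis using that by (metis dvd_triv_left)
qed

text \<open>Natural exponents with sum 0 vanish, which leaves a unit of the integers. This is why
  exchange polynomials are ambiguous only in sign.\<close>

lemma coeffs_unit:
  fixes c :: "'n::{finite,linorder} coeffs"
  assumes "c dvd 1"
  shows "c = 1 \<or> c = - 1"
proof -
  from assms obtain d where "c * d = 1" by (auto simp: dvd_def)
  then obtain m k m' k' where *: "c = Poly_Mapping.single m k" "m + m' = 0" "k * k' = 1"
    by (rule unit_pm_monomial)
  then have "Poly_Mapping.lookup m i + Poly_Mapping.lookup m' i = 0" for i
    by (metis lookup_add lookup_zero)
  then have "m = 0" by (intro poly_mapping_eqI) simp
  moreover have "k = 1 \<or> k = - 1" using *(3) by (metis zmult_eq_1_iff)
  ultimately show ?thesis using *(1) by (auto simp: single_uminus)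
qed

section \<open>Normalisation by monomials\<close>

text \<open>The monomial moves the minimal exponent of each variable to 0. For a variable that does
  not occur this minimum is 0 already; the last conclusion provides the condition
  \<open>lookup m j = 0\<close> of \<open>mutated_poly\<close>.\<close>

lemma laurent_normalize:
  fixes L :: "'n::{finite,linorder} laurent"
  assumes "L \<noteq> 0"
  obtains P m where "laurent_of P = Poly_Mapping.single m 1 * L" "\<And>l. \<not> var l dvd P"
    "\<And>j. \<not> involves j L \<Longrightarrow> Poly_Mapping.lookup m j = 0"
proof -
  let ?K = "Poly_Mapping.keys L"
  have fin: "finite ?K" "?K \<noteq> {}" using assms by auto
  define e where "e l = Min ((\<lambda>k. Poly_Mapping.lookup k l) ` ?K)" for l
  define m where "m = Abs_poly_mapping (\<lambda>l. - e l)"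
  have m: "Poly_Mapping.lookup m l = - e l" for l by (simp add: m_def)
  have e_le: "e l \<le> Poly_Mapping.lookup k l" if "k \<in> ?K" for k l
    unfolding e_def using fin that by (intro Min_le) auto
  have e_at: "\<exists>k\<in>?K. Poly_Mapping.lookup k l = e l" for l
  proof -
    have "e l \<in> (\<lambda>k. Poly_Mapping.lookup k l) ` ?K" unfolding e_def using fin by (intro Min_in) auto
    then show ?thesis by auto
  qed
  have keys: "Poly_Mapping.keys (Poly_Mapping.single m 1 * L) = (+) m ` ?K"
    by (simp add: keys_single_mult)
  then have "Poly_Mapping.lookup k i \<ge> 0" if "k \<in> Poly_Mapping.keys (Poly_Mapping.single m 1 * L)" for k i
    using that e_le by (auto simp: lookup_add m)
  then obtain P where P: "laurent_of P = Poly_Mapping.single m 1 * L"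
    using laurent_of_surj by blast
  have "\<not> var l dvd P" for l
  proof
    assume "var l dvd P"
    obtain k where "k \<in> ?K" "Poly_Mapping.lookup k l = e l" using e_at by blast
    then have "m + k \<in> Poly_Mapping.keys (laurent_of P)" "Poly_Mapping.lookup (m + k) l = 0"
      by (auto simp: P keys lookup_add m)
    then show False using \<open>var l dvd P\<close> by (force simp: keys_laurent_of var_dvd_iff)
  qed
  moreover have "Poly_Mapping.lookup m j = 0" if "\<not> involves j L" for j
    using that e_at[of j] by (auto simp: m involves_def)
  ultimately show ?thesis using that P by blast
qed

text \<open>In both polynomials each variable has minimal exponent 0. Comparing exponents at a term
  of \<open>P\<close> and at a term of \<open>Q\<close> where it is attained bounds \<open>m\<close>
  from above and from below by 0.\<close>

lemma laurent_normal_unique: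
  fixes P Q :: "'n::{finite,linorder} pol"
  assumes "laurent_of P = Poly_Mapping.single m c * laurent_of Q" "\<And>l. \<not> var l dvd P" "\<And>l. \<not> var l dvd Q"
  shows "P = const c * Q"
proof -
  have "c \<noteq> 0"
  proof
    assume "c = 0"
    then have "P = 0" using assms(1) by simp
    then show False using assms(2) by auto
  qed
  then have keys: "int_exp ` Poly_Mapping.keys P = (+) m ` int_exp ` Poly_Mapping.keys Q"
    using assms(1) keys_single_mult[of c m "laurent_of Q"] by (metis keys_laurent_of)
  have "Poly_Mapping.lookup m l = 0" for l
  proof -
    obtain k where k: "k \<in> Poly_Mapping.keys P" "Poly_Mapping.lookup k l = 0"
      using assms(2)[of l] by (auto simp: var_dvd_iff not_less_eq_eq)
    then have "int_exp k \<in> (+) m ` int_exp ` Poly_Mapping.keys Q" using keys by blast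
    then obtain k' where "int_exp k = m + int_exp k'" by auto
    then have "int (Poly_Mapping.lookup k l) = Poly_Mapping.lookup m l + int (Poly_Mapping.lookup k' l)"
      by (metis lookup_add lookup_int_exp)
    then have 1: "Poly_Mapping.lookup m l \<le> 0" using k by simp
    obtain q where q: "q \<in> Poly_Mapping.keys Q" "Poly_Mapping.lookup q l = 0"
      using assms(3)[of l] by (auto simp: var_dvd_iff not_less_eq_eq)
    then have "m + int_exp q \<in> int_exp ` Poly_Mapping.keys P" using keys by blast
    then obtain q' where "int_exp q' = m + int_exp q" by auto
    then have "int (Poly_Mapping.lookup q' l) = Poly_Mapping.lookup m l + int (Poly_Mapping.lookup q l)"
      by (metis lookup_add lookup_int_exp)
    then show ?thesis using 1 q by simp
  qed
  then have "m = 0" by (intro poly_mapping_eqI) simp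
  then have "laurent_of P = const c * laurent_of Q"
    using assms(1) by (simp add: const_def)
  then have "laurent_of P = laurent_of (const c * Q)"
    by (simp add: laurent_of_simps)
  then show ?thesis by simp
qed

text \<open>A Laurent unit is a monomial times a unit coefficient;
  \<open>laurent_normal_unique\<close> with \<open>Q = 1\<close> removes the monomial.\<close>

lemma not_laurent_unit:
  fixes P :: "'n::{finite,linorder} pol"
  assumes "\<not> P dvd 1" "\<And>l. \<not> var l dvd P"
  shows "\<not> laurent_of P dvd 1"
proof
  assume "laurent_of P dvd 1"
  then obtain m c where mc: "laurent_of P = Poly_Mapping.single m c" "c dvd 1" by (elim laurent_unitE)
  have "\<not> var l dvd (1 :: 'n pol)" for l by (auto simp: var_dvd_iff)
  then have "P = const c * 1"
    using mc(1) by (intro laurent_normal_unique[of P m c 1] assms) (simp_all add: laurent_of_simps)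
  then have "P dvd const 1" using comm_ring_hom.hom_dvd[OF comm_ring_hom_const mc(2)] by simp
  then show False using assms(1) by (simp add: const_simps)
qed

text \<open>Given a factorisation of \<open>P\<close>, primality makes one factor a Laurent multiple
  of \<open>P\<close>, so the other one is a Laurent unit. No variable divides it, hence it is a
  unit among the polynomials as well.\<close>

lemma irreducible_if_laurent_prime:
  fixes P :: "'n::{finite,linorder} pol"
  assumes "prime_elem (laurent_of P)" "\<And>l. \<not> var l dvd P"
  shows "irreducible P"
proof (rule irreducibleI)
  show "P \<noteq> 0" using assms(2)[of undefined] by auto
  have "\<not> laurent_of P dvd 1" using assms(1) by (auto simp: prime_elem_def)
  then show "\<not> P dvd 1"
    using comm_ring_hom.hom_dvd[OF comm_ring_hom_laurent_of, of P 1] by (auto simp: laurent_of_simps)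
  fix a b assume ab: "P = a * b"
  have unit: "y dvd 1" if xy: "P = x * y" and dvd: "laurent_of P dvd laurent_of x" for x y
  proof -
    obtain q where "laurent_of x = laurent_of P * q" using dvd by (auto simp: dvd_def)
    then have "laurent_of x = laurent_of x * (laurent_of y * q)"
      using xy by (simp add: laurent_of_simps ac_simps)
    moreover have "x \<noteq> 0" using xy assms(2)[of undefined] by auto
    ultimately have "laurent_of y * q = 1" by simp
    then have "laurent_of y dvd 1" by (metis dvd_triv_left)
    moreover have "\<not> var l dvd y" for l using xy assms(2)[of l] by auto
    ultimately show ?thesis using not_laurent_unit by blast
  qed
  have "laurent_of P dvd laurent_of a \<or> laurent_of P dvd laurent_of b"
    using assms(1) ab by (intro prime_elem_dvd_multD) (auto simp: laurent_of_simps)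
  then show "a dvd 1 \<or> b dvd 1"
    using unit[of a b] unit[of b a] ab by (auto simp: mult.commute)
qed

section \<open>Prime elements of the Laurent polynomial ring\<close>

lemma peval_cong:
  assumes "\<And>i. involves i p \<Longrightarrow> v i = w i"
  shows "peval c v p = peval c w p"
  unfolding peval_def
proof (intro sum.cong prod.cong arg_cong2[of _ _ _ _ "(*)"] refl)
  fix m i assume "m \<in> Poly_Mapping.keys p"
  then have "Poly_Mapping.lookup m i \<noteq> 0 \<Longrightarrow> v i = w i"
    using assms[of i] unfolding involves_def by blast
  then show "v i ^ Poly_Mapping.lookup m i = w i ^ Poly_Mapping.lookup m i"
    by (cases "Poly_Mapping.lookup m i = 0") auto
qed simp_all

text \<open>Specialises the \<open>A\<close> and the \<open>X\<close> indeterminates at once.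
  Rational values give numerical tests for divisibility and nonvanishing; Laurent polynomials as
  values serve to eliminate an indeterminate.\<close>

definition evalAX :: "('n::finite \<Rightarrow> 's::comm_ring_1) \<Rightarrow> ('n \<Rightarrow> 's) \<Rightarrow> (('n \<Rightarrow>\<^sub>0 nat) \<Rightarrow>\<^sub>0 ('n \<Rightarrow>\<^sub>0 nat) \<Rightarrow>\<^sub>0 int) \<Rightarrow> 's" where
  "evalAX a v = peval (peval of_int a) v"

lemma comm_ring_hom_evalA: "comm_ring_hom (peval of_int a)"
  for a :: "'n::finite \<Rightarrow> 's::comm_ring_1"
  by (intro comm_ring_hom_peval comm_ring_hom_of_int)

lemma comm_ring_hom_evalAX: "comm_ring_hom (evalAX a v)"
  unfolding evalAX_def by (intro comm_ring_hom_peval comm_ring_hom_evalA)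

lemma evalAX_const: "evalAX a v (const r) = peval of_int a r"
  by (simp add: evalAX_def peval_const comm_ring_hom_evalA)

lemma evalAX_var: "evalAX a v (var i) = v i"
  by (simp add: evalAX_def peval_var comm_ring_hom_evalA)

lemma evalA_var: "peval of_int a (var r) = a r"
  for a :: "'n::finite \<Rightarrow> 's::comm_ring_1"
  by (simp add: peval_var comm_ring_hom_of_int)

lemmas evalAX_simps = comm_ring_hom.hom_simps[OF comm_ring_hom_evalAX]
  comm_ring_hom.hom_simps[OF comm_ring_hom_evalA] evalAX_const evalAX_var evalA_var

lemma dvd_unit_mult_iff:
  fixes u :: "'a::comm_semiring_1"
  assumes "u dvd 1" shows "x dvd u * y \<longleftrightarrow> x dvd y"
proof
  obtain w where w: "u * w = 1" using assms by (auto simp: dvd_def)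
  assume "x dvd u * y"
  then have "x dvd w * (u * y)" by (rule dvd_mult)
  then show "x dvd y" by (simp add: mult.assoc[symmetric] mult.commute[of w u] w)
qed (rule dvd_mult)

lemma unit_mult_dvd_iff:
  fixes u :: "'a::comm_semiring_1"
  assumes "u dvd 1" shows "u * x dvd y \<longleftrightarrow> x dvd y"
proof
  obtain w where w: "1 = u * w" using assms by (auto simp: dvd_def)
  assume "x dvd y"
  then have "u * x dvd u * (w * y)" by (intro mult_dvd_mono) auto
  then show "u * x dvd y" by (simp add: mult.assoc[symmetric] w[symmetric])
qed (rule dvd_mult_right)

lemma dvd_diff_mult:
  fixes F :: "'a::comm_ring_1"
  assumes "F dvd a - a'" "F dvd b - b'"
  shows "F dvd a * b - a' * b'"
proof -
  have "a * b - a' * b' = a * (b - b') + (a - a') * b'" by (simp add: algebra_simps)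
  then show ?thesis using assms by simp
qed

lemma dvd_diff_add:
  fixes F :: "'a::comm_ring_1"
  assumes "F dvd a - a'" "F dvd b - b'"
  shows "F dvd (a + b) - (a' + b')"
  using dvd_add[OF assms] by (simp add: algebra_simps)

lemma evalAX_cong_mod:
  fixes F :: "'n::{finite,linorder} laurent"
  assumes "\<And>r. F dvd const (var r) - a r" "\<And>l. F dvd var l - v l"
  shows "F dvd laurent_of p - evalAX a v p"
proof (induction p rule: pol_induct)
  case (const r)
  have "F dvd const r - peval of_int a r"
  proof (induction r rule: coeffs_induct)
    case (of_int k)
    show ?case
      by (simp add: comm_ring_hom.hom_of_int[OF comm_ring_hom_const] comm_ring_hom.hom_of_int[OF comm_ring_hom_evalA])
  qed (simp_all add: assms const_simps evalAX_simps dvd_diff_mult dvd_diff_add)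
  then show ?case by (simp add: evalAX_const)
qed (simp_all add: assms laurent_of_simps evalAX_simps dvd_diff_mult dvd_diff_add)

lemma laurent_clear:
  fixes L :: "'n::{finite,linorder} laurent"
  obtains k q where "laurent_of q = laurent_of (Poly_Mapping.single k 1) * L"
proof (cases "L = 0")
  case True
  then show ?thesis using that[of 0] by (simp add: laurent_of_simps)
next
  case False
  then obtain P m where P: "laurent_of P = Poly_Mapping.single m 1 * L" by (rule laurent_normalize)
  \<comment> \<open>The positive and the negative part of \<open>m\<close>, so that both sides are
    multiplied by monomials with natural exponents.\<close>
  let ?k = "Poly_Mapping.map nat m" and ?n = "Poly_Mapping.map (\<lambda>e. nat (- e)) m"
  have "int_exp ?k = int_exp ?n + m"
    by (intro poly_mapping_eqI) (simp add: lookup_add map.rep_eq when_def)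
  then have "laurent_of (Poly_Mapping.single ?n 1 * P) = laurent_of (Poly_Mapping.single ?k 1) * L"
    by (simp add: laurent_of_simps laurent_of_single P mult_single mult.assoc[symmetric])
  then show ?thesis by (rule that)
qed

text \<open>The substitution maps into an integral domain, and a polynomial is in its kernel exactly
  if \<open>F\<close> divides it: the congruences give one direction, the vanishing at
  \<open>F\<close> the other. Because the values \<open>v l\<close> are nonzero, no monomial is
  killed and denominators of Laurent polynomials can be cleared.\<close>

lemma laurent_primeI:
  fixes F :: "'n::{finite,linorder} pol"
  assumes mod: "\<And>r. laurent_of F dvd const (var r) - a r" "\<And>l. laurent_of F dvd var l - v l"
    and v: "\<And>l. v l \<noteq> 0" and F: "F \<noteq> 0" "evalAX a v F = 0"
  shows "prime_elem (laurent_of F)"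
proof -
  let ?\<theta> = "evalAX a v"
  have mono: "?\<theta> (Poly_Mapping.single k 1) \<noteq> 0" for k
  proof -
    have "Poly_Mapping.single k 1 = (\<Prod>i\<in>UNIV. var i ^ Poly_Mapping.lookup k i :: 'n pol)"
      by (subst monomial_eq_prod) (simp add: var_power)
    then show ?thesis by (simp add: evalAX_simps v)
  qed
  have ker: "laurent_of F dvd laurent_of p \<longleftrightarrow> ?\<theta> p = 0" for p
  proof
    assume "?\<theta> p = 0"
    then show "laurent_of F dvd laurent_of p"
      using evalAX_cong_mod[of "laurent_of F" a v p] mod by simp
  next
    assume "laurent_of F dvd laurent_of p"
    then obtain q where q: "laurent_of p = laurent_of F * q" by (auto simp: dvd_def)
    obtain k q' where q': "laurent_of q' = laurent_of (Poly_Mapping.single k 1) * q" by (rule laurent_clear)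
    have "laurent_of (Poly_Mapping.single k 1 * p) = laurent_of (F * q')"
      by (simp add: laurent_of_simps q q' ac_simps)
    then have "Poly_Mapping.single k 1 * p = F * q'" by simp
    then have "?\<theta> (Poly_Mapping.single k 1) * ?\<theta> p = 0"
      using F(2) by (simp add: comm_ring_hom.hom_mult[OF comm_ring_hom_evalAX, symmetric])
        (simp add: comm_ring_hom.hom_mult[OF comm_ring_hom_evalAX])
    then show "?\<theta> p = 0" using mono by simp
  qed
  show ?thesis
  proof (rule prime_elemI)
    show "laurent_of F \<noteq> 0" using F by simp
    show "\<not> laurent_of F dvd 1" using ker[of 1] by (simp add: laurent_of_simps evalAX_simps)
    fix x y assume xy: "laurent_of F dvd x * y"
    obtain k x' where x': "laurent_of x' = laurent_of (Poly_Mapping.single k 1) * x" by (rule laurent_clear)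
    obtain l y' where y': "laurent_of y' = laurent_of (Poly_Mapping.single l 1) * y" by (rule laurent_clear)
    have unit: "laurent_of (Poly_Mapping.single k 1) dvd 1" for k :: "'n \<Rightarrow>\<^sub>0 nat"
      by (simp add: laurent_of_single laurent_monomial_unit)
    have "laurent_of F dvd laurent_of (x' * y')"
    proof -
      have "laurent_of (x' * y') = (laurent_of (Poly_Mapping.single k 1) * laurent_of (Poly_Mapping.single l 1)) * (x * y)"
        unfolding comm_ring_hom.hom_mult[OF comm_ring_hom_laurent_of] x' y' by (simp only: mult_ac)
      then show ?thesis using dvd_mult[OF xy] by (simp only:)
    qed
    then have "?\<theta> x' = 0 \<or> ?\<theta> y' = 0" by (simp add: ker evalAX_simps)
    then have "laurent_of F dvd laurent_of x' \<or> laurent_of F dvd laurent_of y'" by (simp add: ker)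
    then show "laurent_of F dvd x \<or> laurent_of F dvd y"
      using unit by (simp add: x' y' dvd_unit_mult_iff)
  qed
qed

section \<open>Substitution in the exchange relation\<close>

lemma comm_ring_hom_to_fract_const: "comm_ring_hom (\<lambda>r. to_fract (const r))"
  by (rule comm_ring_hom_comp[OF comm_ring_hom_to_fract comm_ring_hom_const])

lemma lvar_nonzero: "lvar i \<noteq> 0"
  by (simp add: lvar_def laurent_var_nonzero)

lemma to_fract_ivar: "to_fract (ivar i) = 1 / lvar i"
proof -
  have "lvar i * to_fract (ivar i) = 1"
    by (simp add: lvar_def var_ivar flip: to_fract_mult)
  then show ?thesis using lvar_nonzero[of i] by (metis nonzero_mult_div_cancel_left)
qed

text \<open>
  \<open>\<phi>\<close> is the substitution $X_i \leftarrow C / X_i$.  It is an involution of the Laurent polynomial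
  ring localised at \<open>C\<close>, hence carries the prime \<open>F\<close> to a prime of the localisation.
\<close>

lemma prime_elem_exchange:
  fixes F C G :: "'n::{finite,linorder} laurent" and i :: 'n
  defines "\<phi> \<equiv> lsubst (lvar(i := to_fract C / lvar i))"
  assumes F: "prime_elem F" and C: "prime_elem C" and FC: "\<not> F dvd C" and CG: "\<not> C dvd G"
    and G: "to_fract G = \<phi> F" and C_fix: "\<phi> C = to_fract C"
  shows "prime_elem G"
proof -
  have C0: "C \<noteq> 0" using C by auto
  interpret \<phi>: comm_ring_hom \<phi>
    unfolding \<phi>_def lsubst_def
    by (intro comm_ring_hom_leval comm_ring_hom_to_fract_const) (simp add: C0 lvar_nonzero)
  have \<phi>_const: "\<phi> (const r) = to_fract (const r)" for r
    by (simp add: \<phi>_def lsubst_def leval_const comm_ring_hom_to_fract_const)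
  have \<phi>_var: "\<phi> (var l) = (if l = i then to_fract C / lvar i else lvar l)" for l
    by (simp add: \<phi>_def lsubst_def leval_var comm_ring_hom_to_fract_const)
  have \<phi>_ivar: "\<phi> (ivar l) = (if l = i then lvar i / to_fract C else 1 / lvar l)" for l
  proof -
    have "\<phi> (var l) * \<phi> (ivar l) = 1" by (simp add: var_ivar \<phi>.hom_one flip: \<phi>.hom_mult)
    then have "\<phi> (ivar l) = 1 / \<phi> (var l)"
      by (metis mult_zero_left nonzero_mult_div_cancel_left zero_neq_one)
    then show ?thesis by (simp add: \<phi>_var)
  qed
  \<comment> \<open>\<open>b\<close> is a numerator of \<open>\<phi> a\<close> over a power of
    \<open>C\<close>; the second equation says that \<open>\<phi>\<close> is an involution, up to
    the same power.\<close>
  have clear: "\<exists>N b. to_fract b = to_fract C ^ N * \<phi> a \<and> \<phi> b = to_fract C ^ N * to_fract a" for a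
  proof (induction a rule: laurent_induct)
    case (const r)
    show ?case by (rule exI[of _ 0], rule exI[of _ "const r"]) (simp add: \<phi>_const)
  next
    case (var l)
    show ?case
      by (rule exI[of _ 0], rule exI[of _ "if l = i then C * ivar i else var l"])
        (use C0 in \<open>auto simp: \<phi>.hom_mult \<phi>_var \<phi>_ivar C_fix to_fract_ivar lvar_def\<close>)
  next
    case (ivar l)
    show ?case
      \<comment> \<open>The inverse of X_i goes to X_i / C, so here one factor \<open>C\<close> is
        needed.\<close>
      by (rule exI[of _ "if l = i then 1 else 0"], rule exI[of _ "if l = i then var i else ivar l"])
        (use C0 in \<open>auto simp: \<phi>.hom_mult \<phi>_var \<phi>_ivar C_fix to_fract_ivar lvar_def\<close>)
  next
    case (add p q)
    then obtain M a N b where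
      "to_fract a = to_fract C ^ M * \<phi> p" "\<phi> a = to_fract C ^ M * to_fract p"
      "to_fract b = to_fract C ^ N * \<phi> q" "\<phi> b = to_fract C ^ N * to_fract q" by blast
    then show ?case
      by (intro exI[of _ "M + N"] exI[of _ "C ^ N * a + C ^ M * b"])
        (simp add: \<phi>.hom_simps to_fract_simps C_fix power_add algebra_simps)
  next
    case (mult p q)
    then obtain M a N b where
      "to_fract a = to_fract C ^ M * \<phi> p" "\<phi> a = to_fract C ^ M * to_fract p"
      "to_fract b = to_fract C ^ N * \<phi> q" "\<phi> b = to_fract C ^ N * to_fract q" by blast
    then show ?case
      by (intro exI[of _ "M + N"] exI[of _ "a * b"])
        (simp add: \<phi>.hom_simps to_fract_simps C_fix power_add algebra_simps)
  qed
  have \<phi>_C_power: "\<phi> (C ^ N) = to_fract C ^ N" for N by (simp add: \<phi>.hom_power C_fix)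
  have \<phi>_G: "\<phi> G = to_fract F"
  proof -
    obtain N b where b: "to_fract b = to_fract C ^ N * \<phi> F" "\<phi> b = to_fract C ^ N * to_fract F"
      using clear by blast
    then have "b = C ^ N * G" by (simp add: G[symmetric] to_fract_simps(9)[symmetric] flip: to_fract_mult)
    then show ?thesis using b(2) C0 by (simp add: \<phi>.hom_mult \<phi>_C_power)
  qed
  have F_C_power: "\<not> F dvd C ^ N" for N
    using FC F by (metis prime_elem_dvd_power)
  \<comment> \<open>The prime \<open>C\<close> does not divide \<open>G\<close>, so its factors pass
    to the cofactor one at a time.\<close>
  have C_power: "C ^ N dvd d" if "C ^ N dvd G * d" for N d
    using that
  proof (induction N arbitrary: d)
    case (Suc N)
    have "C dvd G * d" using Suc.prems by (metis dvd_mult_left power_Suc)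
    then have "C dvd d" using C CG prime_elem_dvd_multD by blast
    then obtain e where e: "d = C * e" by (auto simp: dvd_def)
    then have "C * C ^ N dvd C * (G * e)" using Suc.prems by (simp add: ac_simps)
    then have "C ^ N dvd G * e" using C0 by (simp only: dvd_mult_cancel_left simp_thms)
    then have "C ^ N dvd e" by (rule Suc.IH)
    then show ?case using e by simp
  qed simp
  \<comment> \<open>Applying \<open>\<phi>\<close> to a multiple of \<open>F\<close> gives a
    multiple of \<open>G = \<phi> F\<close>, up to powers of \<open>C\<close>; these are cancelled
    by \<open>C_power\<close>.\<close>
  have step: "G dvd x" if x: "to_fract b = to_fract C ^ N * \<phi> x" "\<phi> b = to_fract C ^ N * to_fract x"
    and F_b: "F dvd b" for x b N
  proof -
    obtain d where d: "b = F * d" using F_b by (auto simp: dvd_def)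
    obtain M e where e: "to_fract e = to_fract C ^ M * \<phi> d" using clear by blast
    have "to_fract (C ^ (M + N) * x) = to_fract C ^ M * \<phi> b"
      by (simp add: x(2) to_fract_simps power_add)
    also have "\<dots> = to_fract (G * e)"
      by (simp add: d \<phi>.hom_mult G e)
    finally have eq: "C ^ (M + N) * x = G * e" by (simp only: to_fract_eq_iff)
    then have "C ^ (M + N) dvd e" using C_power by (metis dvd_triv_left)
    then obtain f where "e = C ^ (M + N) * f" by (auto simp: dvd_def)
    then have "C ^ (M + N) * x = C ^ (M + N) * (G * f)" using eq by (simp add: ac_simps)
    then show ?thesis using C0 by simp
  qed
  show ?thesis
  proof (rule prime_elemI)
    show "G \<noteq> 0" using CG by auto
    show "\<not> G dvd 1"
    proof
      assume "G dvd 1"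
      then obtain u where u: "G * u = 1" by (auto simp: dvd_def)
      obtain N b where b: "to_fract b = to_fract C ^ N * \<phi> u" using clear by blast
      have "to_fract (F * b) = to_fract C ^ N * \<phi> (G * u)"
        by (simp add: b \<phi>.hom_mult \<phi>_G)
      also have "\<dots> = to_fract (C ^ N)" by (simp add: u \<phi>.hom_one to_fract_simps)
      finally have "F * b = C ^ N" by (simp only: to_fract_eq_iff)
      then show False using F_C_power by (metis dvd_triv_left)
    qed
    fix x y assume "G dvd x * y"
    then obtain c where c: "x * y = G * c" by (auto simp: dvd_def)
    obtain K a where a: "to_fract a = to_fract C ^ K * \<phi> x" "\<phi> a = to_fract C ^ K * to_fract x"
      using clear by blast
    obtain M b where b: "to_fract b = to_fract C ^ M * \<phi> y" "\<phi> b = to_fract C ^ M * to_fract y"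
      using clear by blast
    obtain N d where d: "to_fract d = to_fract C ^ N * \<phi> c" using clear by blast
    have "to_fract (C ^ N * (a * b)) = to_fract C ^ (N + K + M) * \<phi> (x * y)"
      by (simp add: a b to_fract_simps \<phi>.hom_mult power_add)
    also have "\<dots> = to_fract (F * (C ^ (K + M) * d))"
      by (simp add: c d \<phi>.hom_mult \<phi>_G to_fract_simps power_add)
    finally have "C ^ N * (a * b) = F * (C ^ (K + M) * d)" by (simp only: to_fract_eq_iff)
    then have "F dvd C ^ N * (a * b)" by (metis dvd_triv_left)
    then have "F dvd a \<or> F dvd b" using F F_C_power prime_elem_dvd_multD by blast
    then show "G dvd x \<or> G dvd y" using step a b by blast
  qed
qed

text \<open>The assumption says that the trivial monomial is admissible. If another one had the
  exponent -n < 0 at \<open>j\<close>, substituting F_j / X_j for X_j would turn X_j^(-n) into a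
  denominator F_j^n; for the result to be a Laurent polynomial, F_j would have to divide the
  substituted F_i.\<close>

lemma hat_eq_laurent_of:
  fixes F :: "'n::{finite,linorder} \<Rightarrow> 'n pol"
  assumes "\<And>j. j \<noteq> i \<Longrightarrow> F j \<noteq> 0"
    and ndvd: "\<And>j. j \<noteq> i \<Longrightarrow> \<not> laurent_of (F j) dvd peval const (var(j := laurent_of (F j) * ivar j)) (F i)"
  shows "hat F i = laurent_of (F i)"
proof -
  define q where "q j = peval const (var(j := laurent_of (F j) * ivar j)) (F i)" for j
  have subst_eq: "lsubst (lvar(j := to_fract (laurent_of (F j)) / lvar j)) (laurent_of (F i)) = to_fract (q j)" for j
    unfolding q_def hom_peval[OF comm_ring_hom_to_fract] lsubst_laurent_of
    by (rule peval_cong) (simp add: to_fract_ivar lvar_def)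
  show ?thesis
    unfolding hat_def
  proof (rule the_equality)
    show "is_hat F i (laurent_of (F i))"
      unfolding is_hat_def
    proof (intro conjI allI impI)
      show "\<exists>a. Poly_Mapping.lookup a i = 0 \<and> (\<forall>j. Poly_Mapping.lookup a j \<le> 0) \<and>
          laurent_of (F i) = Poly_Mapping.single a 1 * laurent_of (F i)"
        by (rule exI[of _ 0]) simp
    next
      fix j assume "j \<noteq> i"
      then show "\<exists>q. lsubst (lvar(j := to_fract (laurent_of (F j)) / lvar j)) (laurent_of (F i)) = to_fract q \<and>
          \<not> laurent_of (F j) dvd q"
        using subst_eq ndvd[of j] by (auto simp: q_def)
    qed
  next
    fix L assume L: "is_hat F i L"
    then obtain a where a: "Poly_Mapping.lookup a i = 0" "\<And>j. Poly_Mapping.lookup a j \<le> 0"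
        "L = Poly_Mapping.single a 1 * laurent_of (F i)"
      unfolding is_hat_def by blast
    have "Poly_Mapping.lookup a j = 0" for j
    proof (rule ccontr)
      assume neg: "Poly_Mapping.lookup a j \<noteq> 0"
      then have j: "j \<noteq> i" using a(1) by auto
      define f where "f = lsubst (lvar(j := to_fract (laurent_of (F j)) / lvar j))"
      interpret f: comm_ring_hom f
        unfolding f_def lsubst_def
        by (intro comm_ring_hom_leval comm_ring_hom_to_fract_const) (simp add: lvar_nonzero assms(1) j)
      have f_var: "f (var j) = to_fract (laurent_of (F j)) / lvar j"
        by (simp add: f_def lsubst_def leval_var comm_ring_hom_to_fract_const)
      have f_Fi: "f (laurent_of (F i)) = to_fract (q j)" unfolding f_def by (rule subst_eq)
      obtain r where r: "f L = to_fract r"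
        using L j unfolding is_hat_def f_def by blast
      have f_unit: "f (Poly_Mapping.single b 1) = to_fract (Poly_Mapping.single b 1)"
        if "Poly_Mapping.lookup b j = 0" for b
      proof -
        have "f (Poly_Mapping.single b 1) = (\<Prod>l\<in>UNIV. lvar l powi Poly_Mapping.lookup b l)"
          unfolding f_def lsubst_def leval_eq_mev
          by (subst mev_single) (auto simp: const_simps that intro!: prod.cong)
        also have "\<dots> = leval (\<lambda>r. to_fract (const r)) lvar (Poly_Mapping.single b 1)"
          unfolding leval_eq_mev by (subst mev_single) (auto simp: const_simps)
        also have "\<dots> = to_fract (Poly_Mapping.single b 1)"
          by (rule laurent_hom_eqI[OF comm_ring_hom_leval comm_ring_hom_to_fract])
            (simp_all add: comm_ring_hom_to_fract_const lvar_nonzero leval_const leval_var lvar_def[symmetric])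
        finally show ?thesis .
      qed
      \<comment> \<open>The part of \<open>a\<close> away from \<open>j\<close>: its monomial is
        fixed by the substitution.\<close>
      define b where "b = a - Poly_Mapping.single j (Poly_Mapping.lookup a j)"
      define n where "n = nat (- Poly_Mapping.lookup a j)"
      have n: "n > 0" "Poly_Mapping.lookup a j = - int n" using neg a(2)[of j] by (auto simp: n_def)
      have b: "Poly_Mapping.lookup b j = 0" by (simp add: b_def lookup_minus)
      have "var j ^ n * L = Poly_Mapping.single b 1 * laurent_of (F i)"
        by (simp add: a(3) var_power mult_single mult.assoc[symmetric] b_def n(2) single_uminus add.commute)
      then have "f (var j ^ n * L) = f (Poly_Mapping.single b 1 * laurent_of (F i))" by (simp only:)
      then have "f (var j) ^ n * f L = to_fract (Poly_Mapping.single b 1) * to_fract (q j)"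
        by (simp only: f.hom_mult f.hom_power f_unit[OF b] f_Fi)
      then have "lvar j ^ n * (f (var j) ^ n * f L)
          = lvar j ^ n * (to_fract (Poly_Mapping.single b 1) * to_fract (q j))" by (simp only:)
      moreover have "lvar j ^ n * (f (var j) ^ n * f L) = to_fract (laurent_of (F j)) ^ n * to_fract r"
        using lvar_nonzero[of j] by (simp add: f_var r power_divide)
      ultimately have "to_fract (laurent_of (F j)) ^ n * to_fract r
          = lvar j ^ n * (to_fract (Poly_Mapping.single b 1) * to_fract (q j))" by (simp only:)
      then have "to_fract (laurent_of (F j) ^ n * r) = to_fract (var j ^ n * (Poly_Mapping.single b 1 * q j))"
        by (simp add: to_fract_simps lvar_def)
      then have "laurent_of (F j) ^ n * r = (var j ^ n * Poly_Mapping.single b 1) * q j"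
        by (simp only: to_fract_eq_iff mult.assoc)
      then have "laurent_of (F j) dvd (var j ^ n * Poly_Mapping.single b 1) * q j"
        using n(1) by (metis dvd_mult2 dvd_power)
      moreover have "var j ^ n * Poly_Mapping.single b 1 dvd (1 :: 'n laurent)"
        by (simp add: var_power mult_single laurent_monomial_unit)
      ultimately show False using ndvd[OF j] by (simp add: q_def dvd_unit_mult_iff)
    qed
    then have "a = 0" by (intro poly_mapping_eqI) simp
    then show "L = laurent_of (F i)" by (simp add: a(3))
  qed
qed

section \<open>Dividing out common factors\<close>

lemma divide_out_dvd:
  assumes "divide_out i j C G H" "C \<noteq> 0"
  obtains q where "q \<noteq> 0" "G = q * H"
proof -
  have "\<exists>q. q \<noteq> 0 \<and> G = q * H"
    using assms
  proof induction
    case (refl G)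
    then show ?case by (intro exI[of _ 1]) simp
  next
    case (step p G H)
    then obtain q where q: "q \<noteq> 0" "G = q * H" by blast
    have "laurent_of p \<noteq> 0" using step by auto
    then show ?case using q by (intro exI[of _ "laurent_of p * q"]) (simp add: mult.assoc)
  qed
  then show ?thesis using that by blast
qed

text \<open>Without common factors other than units every step removes a unit. Together with
  \<open>divide_out_dvd\<close> this makes the result associated with \<open>G\<close>, whatever
  steps were chosen.\<close>

lemma divide_out_coprime_dvd:
  assumes "divide_out i j C G H"
    "\<And>p. \<not> involves i p \<Longrightarrow> \<not> involves j p \<Longrightarrow> laurent_of p dvd C \<Longrightarrow> laurent_of p dvd G \<Longrightarrow> laurent_of p dvd 1"
  shows "G dvd H"
  using assms
proof induction
  case (step p G H)
  have "laurent_of p dvd 1" using step by (intro step.prems) auto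
  moreover have "G dvd H" using step.prems by (intro step.IH) (meson dvd_mult)
  ultimately show ?case by (simp add: unit_mult_dvd_iff)
qed simp

text \<open>For a trivial hat monomial, this and \<open>exchange_subst\<close> are the
  \<open>C\<close> and \<open>G\<close> of \<open>mutated_poly\<close>, written inside the Laurent
  polynomial ring instead of its fraction field.\<close>

definition exchange_const :: "('n::{finite,linorder} \<Rightarrow> 'n pol) \<Rightarrow> 'n \<Rightarrow> 'n \<Rightarrow> 'n laurent" where
  "exchange_const F i j = peval const (var(j := 0)) (F i)"

definition exchange_subst :: "('n::{finite,linorder} \<Rightarrow> 'n pol) \<Rightarrow> 'n \<Rightarrow> 'n \<Rightarrow> 'n laurent" where
  "exchange_subst F i j = peval const (var(i := exchange_const F i j * ivar i)) (F j)"

lemma to_fract_exchange_subst: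
  "to_fract (exchange_subst F i j) = lsubst (lvar(i := to_fract (exchange_const F i j) / lvar i)) (laurent_of (F j))"
  unfolding exchange_subst_def hom_peval[OF comm_ring_hom_to_fract] lsubst_laurent_of
  by (rule peval_cong) (simp add: to_fract_ivar lvar_def)

lemma mutated_poly_iff:
  assumes "hat F i = laurent_of (F i)"
  shows "mutated_poly F i j P \<longleftrightarrow> (\<exists>H m. divide_out i j (exchange_const F i j) (exchange_subst F i j) H \<and>
        (\<forall>p. \<not> involves i p \<longrightarrow> \<not> involves j p \<longrightarrow>
             laurent_of p dvd exchange_const F i j \<longrightarrow> laurent_of p dvd H \<longrightarrow> laurent_of p dvd 1) \<and>
        Poly_Mapping.lookup m j = 0 \<and>
        laurent_of P = Poly_Mapping.single m 1 * H \<and>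
        (\<forall>l. \<not> var l dvd P))"
proof -
  have "to_fract (exchange_const F i j) = lsubst (lvar(j := 0)) (hat F i)"
    unfolding assms exchange_const_def hom_peval[OF comm_ring_hom_to_fract] lsubst_laurent_of
    by (rule peval_cong) (simp add: lvar_def)
  then have C: "to_fract C = lsubst (lvar(j := 0)) (hat F i) \<longleftrightarrow> C = exchange_const F i j" for C
    by (metis to_fract_eq_iff)
  have G: "to_fract G = lsubst (lvar(i := to_fract (exchange_const F i j) / lvar i)) (laurent_of (F j))
      \<longleftrightarrow> G = exchange_subst F i j" for G
    by (metis to_fract_eq_iff to_fract_exchange_subst)
  show ?thesis
    unfolding mutated_poly_def C by (auto simp: G)
qed

section \<open>Variables occurring in polynomials and in their coefficients\<close>

lemma involves_single: "involves i (Poly_Mapping.single m r) \<longleftrightarrow> r \<noteq> 0 \<and> Poly_Mapping.lookup m i \<noteq> 0"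
  by (simp add: involves_def)

lemma not_involves_const [simp]: "\<not> involves i (const r)"
  by (simp add: const_def involves_single)

lemma involves_var [simp]: "involves i (var j :: ('n \<Rightarrow>\<^sub>0 'e::zero_neq_one) \<Rightarrow>\<^sub>0 'r::zero_neq_one) \<longleftrightarrow> i = j"
  by (auto simp: var_def involves_single lookup_single when_def)

lemma involves_ivar [simp]: "involves i (ivar j :: ('n \<Rightarrow>\<^sub>0 int) \<Rightarrow>\<^sub>0 'r::comm_ring_1) \<longleftrightarrow> i = j"
  by (auto simp: ivar_def involves_single lookup_single when_def)

lemma not_involves_one [simp]: "\<not> involves i (1 :: ('n \<Rightarrow>\<^sub>0 'e::comm_monoid_add) \<Rightarrow>\<^sub>0 'r::comm_ring_1)"
  by (simp add: involves_def)

lemma not_involves_zero [simp]: "\<not> involves i 0"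
  by (simp add: involves_def)

lemma not_involves_add: "\<not> involves i p \<Longrightarrow> \<not> involves i q \<Longrightarrow> \<not> involves i (p + q)"
  using keys_add[of p q] by (auto simp: involves_def)

lemma not_involves_mult:
  fixes p q :: "('n \<Rightarrow>\<^sub>0 'e::comm_monoid_add) \<Rightarrow>\<^sub>0 'r::comm_ring_1"
  assumes "\<not> involves i p" "\<not> involves i q"
  shows "\<not> involves i (p * q)"
proof
  assume "involves i (p * q)"
  then obtain m where "m \<in> Poly_Mapping.keys (p * q)" "Poly_Mapping.lookup m i \<noteq> 0"
    by (auto simp: involves_def)
  then obtain a b where "m = a + b" "a \<in> Poly_Mapping.keys p" "b \<in> Poly_Mapping.keys q"
    using keys_mult[of p q] by blast
  then show False using assms \<open>Poly_Mapping.lookup m i \<noteq> 0\<close> by (auto simp: involves_def lookup_add)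
qed

lemma not_involves_power:
  "\<not> involves i p \<Longrightarrow> \<not> involves i (p ^ k :: ('n \<Rightarrow>\<^sub>0 'e::comm_monoid_add) \<Rightarrow>\<^sub>0 'r::comm_ring_1)"
  by (induction k) (simp_all add: not_involves_mult)

lemma not_involves_sum: "(\<And>x. x \<in> I \<Longrightarrow> \<not> involves i (f x)) \<Longrightarrow> \<not> involves i (\<Sum>x\<in>I. f x)"
  for f :: "'b \<Rightarrow> ('n \<Rightarrow>\<^sub>0 'e::comm_monoid_add) \<Rightarrow>\<^sub>0 'r::comm_ring_1"
  by (induction I rule: infinite_finite_induct) (simp_all add: not_involves_add)

lemma not_involves_prod: "(\<And>x. x \<in> I \<Longrightarrow> \<not> involves i (f x)) \<Longrightarrow> \<not> involves i (\<Prod>x\<in>I. f x)"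
  for f :: "'b \<Rightarrow> ('n \<Rightarrow>\<^sub>0 'e::comm_monoid_add) \<Rightarrow>\<^sub>0 'r::comm_ring_1"
  by (induction I rule: infinite_finite_induct) (simp_all add: not_involves_mult)

lemmas not_involves_intros = not_involves_add not_involves_mult not_involves_power not_involves_sum not_involves_prod

lemma not_involves_peval:
  fixes v :: "'n::finite \<Rightarrow> ('m \<Rightarrow>\<^sub>0 'e::comm_monoid_add) \<Rightarrow>\<^sub>0 'r::comm_ring_1"
  assumes "\<And>r. \<not> involves i (c r)" "\<And>l. involves l p \<Longrightarrow> \<not> involves i (v l)"
  shows "\<not> involves i (peval c v p)"
  unfolding peval_def
proof (intro not_involves_sum not_involves_mult not_involves_prod assms(1))
  fix m l assume "m \<in> Poly_Mapping.keys p"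
  then have "Poly_Mapping.lookup m l \<noteq> 0 \<Longrightarrow> \<not> involves i (v l)"
    using assms(2)[of l] unfolding involves_def[of l p] by blast
  then show "\<not> involves i (v l ^ Poly_Mapping.lookup m l)"
    by (cases "Poly_Mapping.lookup m l = 0") (simp_all add: not_involves_power)
qed

text \<open>Absence of \<open>A_\<sigma>\<close>; applied to the whole polynomial,
  \<open>involves\<close> would speak of X_\<sigma> instead.\<close>

definition coeffs_free :: "'n \<Rightarrow> ('k \<Rightarrow>\<^sub>0 'n coeffs) \<Rightarrow> bool" where
  "coeffs_free \<sigma> p \<longleftrightarrow> (\<forall>m. \<not> involves \<sigma> (Poly_Mapping.lookup p m))"

lemma coeffs_free_single: "\<not> involves \<sigma> r \<Longrightarrow> coeffs_free \<sigma> (Poly_Mapping.single m r)"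
  by (auto simp: coeffs_free_def lookup_single when_def)

lemma coeffs_free_const: "\<not> involves \<sigma> r \<Longrightarrow> coeffs_free \<sigma> (const r)"
  unfolding const_def by (rule coeffs_free_single)

lemma coeffs_free_monomial: "coeffs_free \<sigma> (Poly_Mapping.single m 1)"
  by (rule coeffs_free_single) simp

lemma coeffs_free_var: "coeffs_free \<sigma> (var i)" and coeffs_free_ivar: "coeffs_free \<sigma> (ivar i)"
  unfolding var_def ivar_def by (rule coeffs_free_monomial)+

lemma coeffs_free_one: "coeffs_free \<sigma> (1 :: 'k::zero \<Rightarrow>\<^sub>0 'n coeffs)"
  using coeffs_free_monomial[of \<sigma> 0] by simp

lemma coeffs_free_add: "coeffs_free \<sigma> p \<Longrightarrow> coeffs_free \<sigma> q \<Longrightarrow> coeffs_free \<sigma> (p + q)"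
  by (simp add: coeffs_free_def lookup_add not_involves_add)

lemma coeffs_free_sum: "(\<And>x. x \<in> I \<Longrightarrow> coeffs_free \<sigma> (f x)) \<Longrightarrow> coeffs_free \<sigma> (\<Sum>x\<in>I. f x)"
  by (induction I rule: infinite_finite_induct) (simp_all add: coeffs_free_def lookup_add not_involves_add)

lemma coeffs_free_mult:
  fixes p q :: "'k::comm_monoid_add \<Rightarrow>\<^sub>0 'n coeffs"
  assumes "coeffs_free \<sigma> p" "coeffs_free \<sigma> q"
  shows "coeffs_free \<sigma> (p * q)"
proof -
  have "coeffs_free \<sigma> ((\<Sum>a\<in>Poly_Mapping.keys p. Poly_Mapping.single a (Poly_Mapping.lookup p a))
      * (\<Sum>b\<in>Poly_Mapping.keys q. Poly_Mapping.single b (Poly_Mapping.lookup q b)))"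
    unfolding sum_product mult_single
    by (intro coeffs_free_sum coeffs_free_single not_involves_mult)
      (use assms in \<open>auto simp: coeffs_free_def\<close>)
  then show ?thesis using pm_eq_sum_single[of p] pm_eq_sum_single[of q] by simp
qed

lemma coeffs_free_power: "coeffs_free \<sigma> p \<Longrightarrow> coeffs_free \<sigma> (p ^ k :: 'k::comm_monoid_add \<Rightarrow>\<^sub>0 'n coeffs)"
  by (induction k) (auto intro: coeffs_free_mult coeffs_free_one)

lemma coeffs_free_prod: "(\<And>x. x \<in> I \<Longrightarrow> coeffs_free \<sigma> (f x)) \<Longrightarrow> coeffs_free \<sigma> (\<Prod>x\<in>I. f x)"
  for f :: "'b \<Rightarrow> 'k::comm_monoid_add \<Rightarrow>\<^sub>0 'n coeffs"
  by (induction I rule: infinite_finite_induct) (auto intro: coeffs_free_mult coeffs_free_one)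

lemmas coeffs_free_intros = coeffs_free_add coeffs_free_mult coeffs_free_power coeffs_free_sum
  coeffs_free_prod coeffs_free_one coeffs_free_var coeffs_free_ivar coeffs_free_monomial coeffs_free_const

lemma coeffs_free_laurent_of [simp]: "coeffs_free \<sigma> (laurent_of p) \<longleftrightarrow> coeffs_free \<sigma> p"
proof
  assume "coeffs_free \<sigma> (laurent_of p)"
  then show "coeffs_free \<sigma> p" by (metis coeffs_free_def lookup_laurent_of)
next
  assume "coeffs_free \<sigma> p"
  then show "coeffs_free \<sigma> (laurent_of p)"
    unfolding laurent_of_eq_sum by (intro coeffs_free_sum coeffs_free_single) (simp add: coeffs_free_def)
qed

lemma coeffs_free_peval:
  fixes v :: "'n::finite \<Rightarrow> ('n \<Rightarrow>\<^sub>0 'e::comm_monoid_add) \<Rightarrow>\<^sub>0 'n coeffs"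
  assumes "coeffs_free \<sigma> p" "\<And>l. coeffs_free \<sigma> (v l)"
  shows "coeffs_free \<sigma> (peval const v p)"
  unfolding peval_def
  by (intro coeffs_free_sum coeffs_free_mult coeffs_free_prod coeffs_free_power coeffs_free_const assms)
    (use assms(1) in \<open>simp add: coeffs_free_def\<close>)

text \<open>
  Divisors of polynomials in which $A_\sigma$ does not occur: the degree in \<open>T\<close> of the image under
  $A_\sigma \mapsto A_\sigma + T$ is additive.
\<close>

lemma coeffs_free_divisor:
  fixes a b :: "'n::{finite,linorder} laurent"
  assumes free: "coeffs_free \<sigma> (a * b)" and nz: "a * b \<noteq> 0"
  shows "coeffs_free \<sigma> a"
proof -
  define c :: "'n coeffs \<Rightarrow> 'n laurent poly" where
    "c = peval of_int (\<lambda>r. [:const (var r), if r = \<sigma> then 1 else 0:])"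
  define D where "D = mev c (\<lambda>m. [:Poly_Mapping.single m 1:])"
  define \<theta>0 :: "'n coeffs \<Rightarrow> 'n coeffs" where "\<theta>0 = peval of_int (var(\<sigma> := 0))"
  define \<theta> :: "'n laurent \<Rightarrow> 'n laurent" where "\<theta> = mev (\<lambda>r. const (\<theta>0 r)) (\<lambda>m. Poly_Mapping.single m 1)"
  have hc: "comm_ring_hom c" unfolding c_def by (rule comm_ring_hom_evalA)
  have h0: "comm_ring_hom \<theta>0" unfolding \<theta>0_def by (rule comm_ring_hom_evalA)
  have hc0: "comm_ring_hom (\<lambda>r. const (\<theta>0 r) :: 'n laurent)"
    by (rule comm_ring_hom_comp[OF comm_ring_hom_const h0])
  have hD: "comm_ring_hom D"
    unfolding D_def by (rule comm_ring_hom_mev[OF hc]) (simp_all add: mult_single one_pCons add.commute)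
  have h\<theta>: "comm_ring_hom \<theta>"
    unfolding \<theta>_def by (rule comm_ring_hom_mev[OF hc0]) (simp_all add: mult_single)
  have D_const: "D (const r) = c r" for r
    by (simp add: D_def const_def mev_single comm_ring_hom.hom_zero[OF hc] flip: one_pCons)
  have D_var: "D (var i) = [:var i:]" for i
    by (simp add: D_def var_def mev_single comm_ring_hom.hom_simps[OF hc])
  have \<theta>_const: "\<theta> (const r) = const (\<theta>0 r)" for r
    unfolding \<theta>_def by (subst const_def) (simp add: mev_single comm_ring_hom.hom_zero[OF hc0])
  have \<theta>_var: "\<theta> (var i) = var i" for i
    by (simp add: \<theta>_def var_def mev_single comm_ring_hom.hom_simps[OF hc0])
  have hpoly: "comm_ring_hom (\<lambda>p. poly p x)" for x :: "'n laurent"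
    by (simp add: comm_ring_hom_def)
  have hpC: "comm_ring_hom (\<lambda>x :: 'n laurent. [:x:])"
    by (simp add: comm_ring_hom_def one_pCons)
  have D_at_0: "poly (D p) 0 = p" for p
  proof (rule laurent_hom_eqI[OF comm_ring_hom_comp[OF hpoly hD] comm_ring_hom_id])
    have "poly (c r) 0 = const r" for r
      by (rule coeffs_hom_eqI[OF comm_ring_hom_comp[OF hpoly hc] comm_ring_hom_const])
        (simp add: c_def evalA_var)
    then show "poly (D (const r)) 0 = const r" for r by (simp add: D_const)
  qed (simp add: D_var)
  have D_at_A: "poly (D p) (- const (var \<sigma>)) = \<theta> p" for p
  proof (rule laurent_hom_eqI[OF comm_ring_hom_comp[OF hpoly hD] h\<theta>])
    have "poly (c r) (- const (var \<sigma>)) = const (\<theta>0 r)" for r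
      by (rule coeffs_hom_eqI[OF comm_ring_hom_comp[OF hpoly hc] hc0])
        (auto simp: c_def \<theta>0_def evalA_var const_simps)
    then show "poly (D (const r)) (- const (var \<sigma>)) = \<theta> (const r)" for r by (simp add: D_const \<theta>_const)
  qed (simp add: D_var \<theta>_var)
  have free_\<theta>: "coeffs_free \<sigma> (\<theta> p)" for p
    unfolding \<theta>_def mev_def \<theta>0_def
    by (intro coeffs_free_intros not_involves_peval) (auto simp flip: const_simps(2) simp: single_of_int[symmetric] involves_single simp del: single_of_int)
  have D_free: "D p = [:p:]" if "coeffs_free \<sigma> p" for p
  proof -
    have "c r = [:const r:]" if "\<not> involves \<sigma> r" for r
    proof -
      have "c r = peval of_int (\<lambda>r. [:const (var r):]) r"
        unfolding c_def by (rule peval_cong) (use that in auto)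
      also have "\<dots> = [:const r:]"
        by (rule coeffs_hom_eqI[OF comm_ring_hom_evalA comm_ring_hom_comp[OF hpC comm_ring_hom_const]])
          (simp add: evalA_var)
      finally show ?thesis .
    qed
    then have "D p = (\<Sum>m\<in>Poly_Mapping.keys p. [:const (Poly_Mapping.lookup p m) * Poly_Mapping.single m 1:])"
      unfolding D_def mev_def using that by (intro sum.cong) (auto simp: coeffs_free_def)
    also have "\<dots> = [:\<Sum>m\<in>Poly_Mapping.keys p. const (Poly_Mapping.lookup p m) * Poly_Mapping.single m 1:]"
      by (rule comm_ring_hom.hom_sum[OF hpC, symmetric])
    also have "(\<Sum>m\<in>Poly_Mapping.keys p. const (Poly_Mapping.lookup p m) * Poly_Mapping.single m 1) = p"
      using pm_eq_sum_single[of p] by (simp flip: single_eq_const_mult)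
    finally show ?thesis .
  qed
  have eq: "D a * D b = [:a * b:]"
    using D_free[OF free] by (simp add: comm_ring_hom.hom_mult[OF hD])
  then have "D a \<noteq> 0" "D b \<noteq> 0" using nz by auto
  then have "degree (D a) + degree (D b) = degree [:a * b:]" by (metis eq degree_mult_eq)
  then have "degree (D a) = 0" by simp
  then obtain x where x: "D a = [:x:]" by (rule degree_eq_zeroE)
  \<comment> \<open>A polynomial constant in \<open>T\<close> has the same value at T = 0, which is
    \<open>a\<close>, and at T = - A_\<sigma>, which is \<open>a\<close> with
    \<open>A_\<sigma>\<close> set to 0.\<close>
  then have "\<theta> a = a" using D_at_0[of a] D_at_A[of a] by simp
  then show ?thesis using free_\<theta>[of a] by simp
qed

section \<open>The exchange polynomials\<close>

text \<open>The variable standing for Y_s, read as 1 for the empty sequence. It is polymorphic in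
  the exponents to serve polynomials and Laurent polynomials alike.\<close>

definition last_var :: "'n list \<Rightarrow> ('n \<Rightarrow>\<^sub>0 'e::comm_semiring_1) \<Rightarrow>\<^sub>0 'r::comm_ring_1" where
  "last_var s = (if s = [] then 1 else var (last s))"

text \<open>Extends \<open>reference_poly\<close> to the empty sequence, where it yields the initial
  exchange polynomials.\<close>

definition exchange_poly :: "'n::{finite,linorder} list \<Rightarrow> 'n \<Rightarrow> 'n pol" where
  "exchange_poly s \<sigma> = (\<Prod>r\<in>set s. const (var r)) * (\<Prod>\<rho>\<in>UNIV - set s - {\<sigma>}. var \<rho>) + const (var \<sigma>) * last_var s"

lemma reference_poly_eq: "s \<noteq> [] \<Longrightarrow> reference_poly s \<sigma> = exchange_poly s \<sigma>"
  by (simp add: reference_poly_def exchange_poly_def last_var_def)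

lemma prod_fun_upd:
  fixes U :: "'n::finite set" and f :: "'n \<Rightarrow> 'a::comm_monoid_mult"
  shows "(\<Prod>l\<in>U. (f(i := t)) l) = (if i \<in> U then t * (\<Prod>l\<in>U - {i}. f l) else (\<Prod>l\<in>U. f l))"
proof (cases "i \<in> U")
  case True
  have "(\<Prod>l\<in>U. (f(i := t)) l) = (f(i := t)) i * (\<Prod>l\<in>U - {i}. (f(i := t)) l)"
    using True by (intro prod.remove) auto
  also have "(\<Prod>l\<in>U - {i}. (f(i := t)) l) = (\<Prod>l\<in>U - {i}. f l)" by (intro prod.cong) auto
  finally show ?thesis using True by simp
next
  case False
  then show ?thesis by (auto intro!: prod.cong)
qed

lemma evalAX_exchange_poly:
  "evalAX a v (exchange_poly s \<sigma>) =
    (\<Prod>r\<in>set s. a r) * (\<Prod>\<rho>\<in>UNIV - set s - {\<sigma>}. v \<rho>) + a \<sigma> * (if s = [] then 1 else v (last s))"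
  by (simp add: exchange_poly_def last_var_def evalAX_simps)

lemma laurent_of_last_var: "laurent_of (last_var s) = last_var s"
  by (simp add: last_var_def laurent_of_simps)

lemma laurent_of_exchange_poly:
  "laurent_of (exchange_poly s \<sigma>) =
    (\<Prod>r\<in>set s. const (var r)) * (\<Prod>\<rho>\<in>UNIV - set s - {\<sigma>}. var \<rho>) + const (var \<sigma>) * last_var s"
  by (simp add: exchange_poly_def laurent_of_simps laurent_of_last_var)

lemma last_var_unit: "(last_var s :: ('n \<Rightarrow>\<^sub>0 int) \<Rightarrow>\<^sub>0 'r::comm_ring_1) dvd 1"
  by (simp add: last_var_def laurent_var_unit)

text \<open>At X_l = 0 and all other indeterminates 1 both terms are nonnegative. The second is 1
  unless \<open>l\<close> is the last mutated index, and in that case the first is 1.\<close>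

lemma not_var_dvd_exchange_poly: "\<not> var l dvd exchange_poly s \<sigma>"
proof
  assume dvd: "var l dvd exchange_poly s \<sigma>"
  let ?v = "(\<lambda>_. 1)(l := 0 :: rat)"
  have "evalAX (\<lambda>_. 1) ?v (exchange_poly s \<sigma>) = 0"
    using comm_ring_hom.hom_dvd[OF comm_ring_hom_evalAX dvd, of "\<lambda>_. 1" ?v] by (simp add: evalAX_simps)
  moreover have "(\<Prod>\<rho>\<in>UNIV - set s - {\<sigma>}. ?v \<rho>) \<ge> 0" by (intro prod_nonneg) auto
  moreover have "(\<Prod>\<rho>\<in>UNIV - set s - {\<sigma>}. ?v \<rho>) = 1" if "s \<noteq> []" "l = last s"
    using that by (intro prod.neutral) auto
  ultimately show False by (auto simp: evalAX_exchange_poly split: if_splits)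
qed

lemma exchange_poly_nonzero: "exchange_poly s \<sigma> \<noteq> 0"
  using not_var_dvd_exchange_poly[of undefined s \<sigma>] by auto

lemma not_involves_exchange_poly:
  assumes "l \<in> set s \<or> l = \<sigma>" "s = [] \<or> l \<noteq> last s"
  shows "\<not> involves l (exchange_poly s \<sigma>)"
  unfolding exchange_poly_def last_var_def using assms
  by (intro not_involves_intros) auto

text \<open>With all other indeterminates 1, raising X_l from 1 to 2 raises the value from 2 to
  3.\<close>

lemma involves_exchange_poly:
  assumes "l \<notin> set s" "l \<noteq> \<sigma>"
  shows "involves l (exchange_poly s \<sigma>)"
proof (rule ccontr)
  assume "\<not> involves l (exchange_poly s \<sigma>)"
  then have "evalAX (\<lambda>_. 1) ((\<lambda>_. 1)(l := 2 :: rat)) (exchange_poly s \<sigma>) = evalAX (\<lambda>_. 1) (\<lambda>_. 1) (exchange_poly s \<sigma>)"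
    unfolding evalAX_def by (intro peval_cong) auto
  moreover have "(if s = [] then 1 else ((\<lambda>_. 1)(l := 2 :: rat)) (last s)) = 1"
  proof -
    have "s = [] \<or> last s \<noteq> l" using assms(1) last_in_set by blast
    then show ?thesis by auto
  qed
  ultimately show False
    using assms by (simp add: evalAX_exchange_poly prod_fun_upd del: fun_upd_apply)
qed

lemma coeffs_free_exchange_poly:
  assumes "\<tau> \<notin> set s" "\<tau> \<noteq> \<sigma>"
  shows "coeffs_free \<tau> (exchange_poly s \<sigma>)"
  unfolding exchange_poly_def last_var_def using assms
  by (auto intro!: coeffs_free_intros)

abbreviation AL :: "'n \<Rightarrow> ('n \<Rightarrow>\<^sub>0 'e::zero) \<Rightarrow>\<^sub>0 'n coeffs" where
  "AL r \<equiv> const (var r)"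

lemma evalA_AL: "peval of_int AL = const"
proof
  fix r :: "'n::finite coeffs"
  show "peval of_int AL r = (const r :: ('n \<Rightarrow>\<^sub>0 'e::comm_monoid_add) \<Rightarrow>\<^sub>0 'n coeffs)"
    by (rule coeffs_hom_eqI[OF comm_ring_hom_evalA comm_ring_hom_const]) (simp add: evalA_var)
qed

lemma peval_const_eq_evalAX: "peval const v = evalAX AL v"
  by (simp add: evalAX_def evalA_AL)

lemma laurent_of_eq_evalAX: "laurent_of p = evalAX AL var p"
  by (simp add: laurent_of_def peval_const_eq_evalAX)

text \<open>Modulo the exchange polynomial, $A_\sigma$ is a function of the other indeterminates.\<close>

lemma prime_exchange_poly:
  assumes "\<sigma> \<notin> set s"
  shows "prime_elem (laurent_of (exchange_poly s \<sigma>))"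
proof -
  let ?PM = "(\<Prod>r\<in>set s. AL r) * (\<Prod>\<rho>\<in>UNIV - set s - {\<sigma>}. var \<rho>) :: 'a laurent"
  obtain w :: "'a laurent" where w: "last_var s * w = 1"
    using last_var_unit[of s] by (metis dvdE)
  show ?thesis
  proof (rule laurent_primeI[where a = "AL(\<sigma> := - (?PM * w))" and v = var])
    fix r
    have "AL \<sigma> + ?PM * w = laurent_of (exchange_poly s \<sigma>) * w"
      using w by (simp add: laurent_of_exchange_poly algebra_simps)
    then show "laurent_of (exchange_poly s \<sigma>) dvd AL r - (AL(\<sigma> := - (?PM * w))) r" by auto
  next
    show "(var l :: 'a laurent) \<noteq> 0" for l by (rule laurent_var_nonzero)
    have "evalAX (AL(\<sigma> := - (?PM * w))) var (exchange_poly s \<sigma>) = ?PM - ?PM * w * last_var s"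
      using assms by (simp add: evalAX_exchange_poly prod_fun_upd last_var_def del: fun_upd_apply) (simp add: fun_upd_same)
    then show "evalAX (AL(\<sigma> := - (?PM * w))) var (exchange_poly s \<sigma>) = 0"
      using w by (simp add: mult.assoc mult.commute[of w])
  qed (simp_all add: exchange_poly_nonzero)
qed

lemma prime_AL: "prime_elem (AL i :: 'n::{finite,linorder} laurent)"
proof -
  have "prime_elem (laurent_of (const (var i)) :: 'n laurent)"
  proof (rule laurent_primeI[where a = "AL(i := 0)" and v = var])
    show "(var l :: 'n laurent) \<noteq> 0" for l by (rule laurent_var_nonzero)
    \<comment> \<open>This evaluation counts the terms of a polynomial, so it would give 0 at the
      zero polynomial.\<close>
    have "peval (\<lambda>_. 1) (\<lambda>_. 1 :: rat) (const (var i) :: 'n pol) \<noteq> 0"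
      by (simp add: peval_def const_def var_def)
    then show "(const (var i) :: 'n pol) \<noteq> 0" by (auto simp: peval_def)
  qed (auto simp: evalAX_simps)
  then show ?thesis by simp
qed

section \<open>Evaluation of the coefficients\<close>

lemma mev_const:
  assumes "comm_ring_hom c" "\<mu> 0 = 1"
  shows "mev c \<mu> (const r) = c r"
  by (simp add: const_def mev_single comm_ring_hom.hom_zero[OF assms(1)] assms(2))

lemma mev_monomial:
  assumes "comm_ring_hom c"
  shows "mev c \<mu> (Poly_Mapping.single m 1) = \<mu> m"
  by (simp add: mev_single comm_ring_hom.hom_simps[OF assms])

text \<open>Setting every X to 1 is legitimate for Laurent polynomials, as a unit goes to a unit. A
  divisor that vanishes under \<open>valA a\<close> forces every multiple to vanish. Its companion
  \<open>subA\<close> keeps the X variables.\<close>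

definition valA :: "('n \<Rightarrow> rat) \<Rightarrow> 'n::{finite,linorder} laurent \<Rightarrow> rat" where
  "valA a = mev (peval of_int a) (\<lambda>_. 1)"

definition subA :: "('n \<Rightarrow> 'n laurent) \<Rightarrow> 'n::{finite,linorder} laurent \<Rightarrow> 'n laurent" where
  "subA a = mev (peval of_int a) (\<lambda>m. Poly_Mapping.single m 1)"

lemma comm_ring_hom_valA: "comm_ring_hom (valA a)"
  unfolding valA_def by (rule comm_ring_hom_mev[OF comm_ring_hom_evalA]) simp_all

lemma comm_ring_hom_subA: "comm_ring_hom (subA a)"
  unfolding subA_def by (rule comm_ring_hom_mev[OF comm_ring_hom_evalA]) (simp_all add: mult_single)

lemma valA_const: "valA a (const r) = peval of_int a r"
  unfolding valA_def by (rule mev_const[OF comm_ring_hom_evalA]) simp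

lemma subA_const: "subA a (const r) = peval of_int a r"
  unfolding subA_def by (rule mev_const[OF comm_ring_hom_evalA]) simp

lemma valA_var: "valA a (var i) = 1"
  unfolding valA_def var_def by (rule mev_monomial[OF comm_ring_hom_evalA])

lemma subA_var: "subA a (var i) = var i"
  unfolding subA_def var_def by (rule mev_monomial[OF comm_ring_hom_evalA])

lemma valA_peval: "valA a (peval const v p) = evalAX a (\<lambda>l. valA a (v l)) p"
  unfolding hom_peval[OF comm_ring_hom_valA] by (simp add: valA_const evalAX_def)

lemma subA_peval: "subA a (peval const v p) = evalAX a (\<lambda>l. subA a (v l)) p"
  unfolding hom_peval[OF comm_ring_hom_subA] by (simp add: subA_const evalAX_def)

lemma valA_laurent_of: "valA a (laurent_of p) = evalAX a (\<lambda>_. 1) p"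
  by (simp add: laurent_of_def valA_peval valA_var)

lemma subA_laurent_of: "subA a (laurent_of p) = evalAX a var p"
  by (simp add: laurent_of_def subA_peval subA_var)

lemma evalAX_coeffs_free:
  assumes "coeffs_free \<sigma> p"
  shows "evalAX (a(\<sigma> := t)) v p = evalAX a v p"
proof -
  have "peval of_int (a(\<sigma> := t)) (Poly_Mapping.lookup p m) = peval of_int a (Poly_Mapping.lookup p m)" for m
    by (rule peval_cong) (use assms in \<open>auto simp: coeffs_free_def\<close>)
  then show ?thesis by (simp add: evalAX_def peval_def[of "peval of_int _"])
qed

section \<open>Mutation of the exchange polynomials\<close>

text \<open>A common divisor \<open>p\<close> is not divisible by the prime \<open>D\<close>, since
  it divides \<open>G\<close>. So \<open>D\<close> divides the cofactor of \<open>p\<close> in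
  \<open>C\<close>, and \<open>p\<close> is left as a divisor of the unit \<open>u\<close>.\<close>

lemma coprime_if_prime:
  fixes C D G :: "'a::idom"
  assumes "prime_elem D" "C = D * u" "u dvd 1" "\<not> D dvd G" "p dvd C" "p dvd G"
  shows "p dvd 1"
proof -
  obtain q where q: "D * u = p * q" using assms(2,5) by (auto simp: dvd_def)
  then have "D dvd p * q" by (metis dvd_triv_left)
  moreover have "\<not> D dvd p" using assms(4,6) dvd_trans by blast
  ultimately have "D dvd q" using assms(1) prime_elem_dvd_multD by blast
  then obtain r where "q = D * r" by (auto simp: dvd_def)
  then have "D * u = D * (p * r)" using q by (simp add: ac_simps)
  then have "u = p * r" using assms(1) by auto
  then show ?thesis using assms(3) dvd_trans by (metis dvd_triv_left)
qed

text \<open>Raising \<open>A_i\<close> by 1 leaves \<open>f\<close> unchanged and adds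
  \<open>last_var s\<close> to the exchange polynomial. If \<open>f\<close> divided the latter, it
  would divide the difference of the two values, which is a unit.\<close>

lemma coeffs_free_not_dvd_exchange_poly:
  fixes f :: "'n::{finite,linorder} pol"
  assumes i: "i \<notin> set s" and free: "coeffs_free i f" and unit: "\<not> laurent_of f dvd 1"
  shows "\<not> laurent_of f dvd laurent_of (exchange_poly s i)"
proof
  assume "laurent_of f dvd laurent_of (exchange_poly s i)"
  then obtain q where q: "laurent_of (exchange_poly s i) = laurent_of f * q" by (auto simp: dvd_def)
  let ?a = "AL(i := AL i + 1)"
  have "subA ?a (laurent_of f) = laurent_of f"
    using free by (simp add: subA_laurent_of evalAX_coeffs_free[of i]) (simp add: laurent_of_eq_evalAX)
  then have "evalAX ?a var (exchange_poly s i) = laurent_of f * subA ?a q"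
    using arg_cong[OF q, of "subA ?a"] by (simp only: comm_ring_hom.hom_mult[OF comm_ring_hom_subA]) (simp only: subA_laurent_of)
  moreover have "evalAX ?a var (exchange_poly s i) = laurent_of (exchange_poly s i) + last_var s"
    using i by (simp add: evalAX_exchange_poly prod_fun_upd laurent_of_exchange_poly del: fun_upd_apply)
      (simp add: last_var_def algebra_simps)
  ultimately have "last_var s = laurent_of f * (subA ?a q - q)"
    using q by (simp add: algebra_simps)
  then have "laurent_of f dvd last_var s" by simp
  then show False using unit last_var_unit[of s] dvd_trans by blast
qed

lemma hat_exchange_poly:
  fixes F :: "'n::{finite,linorder} \<Rightarrow> 'n pol"
  assumes i: "i \<notin> set s" and Fi: "F i = exchange_poly s i"
    and unit: "\<And>j. \<not> laurent_of (F j) dvd 1" and nz: "\<And>j. F j \<noteq> 0"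
    and new: "\<And>j. j \<notin> set s \<Longrightarrow> F j = exchange_poly s j"
    and last: "s \<noteq> [] \<Longrightarrow> \<exists>s'. F (last s) = exchange_poly s' (last s) \<and> last s \<notin> set s'"
    and free: "\<And>j. j \<in> set s \<Longrightarrow> coeffs_free i (F j)"
  shows "hat F i = laurent_of (F i)"
proof (rule hat_eq_laurent_of[OF nz])
  fix j assume ji: "j \<noteq> i"
  let ?q = "peval const (var(j := laurent_of (F j) * ivar j)) (F i)"
  show "\<not> laurent_of (F j) dvd ?q"
  proof
    assume dvd: "laurent_of (F j) dvd ?q"
    show False
    proof (cases "j \<in> set s \<and> j \<noteq> last s")
      case True
      \<comment> \<open>X_j does not occur in F_i, so the substitution has no effect.\<close>
      have "?q = laurent_of (F i)"
        unfolding laurent_of_def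
        by (rule peval_cong) (use True not_involves_exchange_poly[of j s i] Fi in auto)
      then show False
        using coeffs_free_not_dvd_exchange_poly[OF i free unit, of j] True dvd Fi by simp
    next
      case False
      have "\<exists>s'. F j = exchange_poly s' j \<and> j \<notin> set s'"
      proof (cases "j \<in> set s")
        case True
        then have "s \<noteq> []" "j = last s" using False by auto
        then show ?thesis using last by simp
      next
        case False
        then show ?thesis using new by blast
      qed
      then obtain s' where s': "F j = exchange_poly s' j" "j \<notin> set s'" by blast
      \<comment> \<open>Here F_j takes the value 1 - 1 = 0, so F_i is evaluated at X_j = 0. If
        \<open>j\<close> is the last mutated index, only its first term survives, with value -1; if
        \<open>j\<close> is unmutated, only the second, with value 1.\<close>
      let ?a = "(\<lambda>_. 1)(j := - 1)"
      have "valA ?a (laurent_of (F j)) = 0"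
        using s' by (simp add: valA_laurent_of evalAX_exchange_poly prod_fun_upd del: fun_upd_apply) simp
      then have "valA ?a ?q = 0"
        using comm_ring_hom.hom_dvd[OF comm_ring_hom_valA dvd, of ?a] by simp
      moreover have "valA ?a ?q = evalAX ?a ((\<lambda>_. 1)(j := 0)) (F i)"
        using \<open>valA ?a (laurent_of (F j)) = 0\<close>
        by (auto simp: valA_peval valA_var comm_ring_hom.hom_mult[OF comm_ring_hom_valA]
            intro!: arg_cong[of _ _ "\<lambda>v. evalAX ?a v (F i)"])
      moreover have "evalAX ?a ((\<lambda>_. 1)(j := 0)) (F i) \<noteq> (0 :: rat)"
      proof (cases "j \<in> set s")
        case True
        then show ?thesis
          using False ji by (simp add: Fi evalAX_exchange_poly prod_fun_upd del: fun_upd_apply) auto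
      next
        case False
        then have "s \<noteq> [] \<Longrightarrow> last s \<noteq> j" by auto
        then show ?thesis
          using False ji by (simp add: Fi evalAX_exchange_poly prod_fun_upd del: fun_upd_apply) auto
      qed
      ultimately show False by simp
    qed
  qed
qed

context
  fixes F :: "'n::{finite,linorder} \<Rightarrow> 'n pol" and s :: "'n list" and i j :: 'n
  assumes i: "i \<notin> set s" and Fi: "F i = exchange_poly s i"
begin

lemma exchange_const_new:
  assumes j: "j \<notin> set s" "j \<noteq> i"
  shows "exchange_const F i j = AL i * last_var s"
proof -
  have "s \<noteq> [] \<Longrightarrow> last s \<noteq> j" using j by auto
  then show ?thesis
    using j by (simp add: exchange_const_def Fi peval_const_eq_evalAX evalAX_exchange_poly prod_fun_upd del: fun_upd_apply)
      (auto simp: last_var_def)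
qed

text \<open>Write P for the product of the \<open>A_r\<close> with \<open>r\<close> in
  \<open>s\<close>, M for that of the remaining X, and Y for \<open>last_var s\<close>. Then F_j = P
  M X_i + A_j Y becomes P M A_i Y / X_i + A_j Y, which is Y / X_i times the new exchange polynomial.
  The equation is stated with X_i and Y multiplied through to avoid inverses.\<close>

lemma exchange_subst_new:
  assumes j: "j \<notin> set s" "j \<noteq> i" and Fj: "F j = exchange_poly s j"
  shows "laurent_of (exchange_poly (s @ [i]) j) * last_var s = var i * exchange_subst F i j"
proof -
  have last: "s \<noteq> [] \<Longrightarrow> last s \<noteq> i" using i by auto
  have U: "UNIV - set (s @ [i]) - {j} = UNIV - set s - {j} - {i}" by auto
  have "exchange_subst F i j = (\<Prod>r\<in>set s. AL r) * (AL i * last_var s * ivar i * (\<Prod>\<rho>\<in>UNIV - set s - {j} - {i}. var \<rho>))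
      + AL j * last_var s"
    using i j last by (simp add: exchange_subst_def exchange_const_new Fj peval_const_eq_evalAX
        evalAX_exchange_poly prod_fun_upd del: fun_upd_apply) (auto simp: last_var_def)
  then have "var i * exchange_subst F i j = (var i * ivar i) * ((\<Prod>r\<in>set s. AL r) * AL i * last_var s * (\<Prod>\<rho>\<in>UNIV - set s - {j} - {i}. var \<rho>))
      + AL j * last_var s * var i"
    by (simp add: algebra_simps)
  moreover have "laurent_of (exchange_poly (s @ [i]) j)
      = AL i * (\<Prod>r\<in>set s. AL r) * (\<Prod>\<rho>\<in>UNIV - set s - {j} - {i}. var \<rho>) + AL j * var i"
    unfolding laurent_of_exchange_poly U using i by (simp add: last_var_def)
  ultimately show ?thesis
    by (simp add: var_ivar algebra_simps)
qed

text \<open>The constant is \<open>A_i\<close> times a unit. At A_i = 0 and all other indeterminates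
  1 the new exchange polynomial has the value 1, so \<open>A_i\<close> does not divide it.\<close>

lemma exchange_coprime_new:
  assumes j: "j \<notin> set s" "j \<noteq> i" and Fj: "F j = exchange_poly s j"
    and p: "p dvd exchange_const F i j" "p dvd exchange_subst F i j"
  shows "p dvd 1"
proof (rule coprime_if_prime[OF prime_AL[of i] exchange_const_new[OF j] last_var_unit _ p])
  show "\<not> AL i dvd exchange_subst F i j"
  proof
    assume "AL i dvd exchange_subst F i j"
    then have "AL i dvd laurent_of (exchange_poly (s @ [i]) j) * last_var s"
      by (simp add: exchange_subst_new[OF j Fj])
    then have "AL i dvd laurent_of (exchange_poly (s @ [i]) j)"
      by (simp add: mult.commute[of _ "last_var s"] dvd_unit_mult_iff last_var_unit)
    then have "valA ((\<lambda>_. 1)(i := 0)) (AL i) dvd valA ((\<lambda>_. 1)(i := 0)) (laurent_of (exchange_poly (s @ [i]) j))"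
      by (rule comm_ring_hom.hom_dvd[OF comm_ring_hom_valA])
    then show False
      using j i by (simp add: valA_const evalA_var valA_laurent_of evalAX_exchange_poly prod_fun_upd del: fun_upd_apply) simp
  qed
qed

lemma exchange_const_old:
  assumes "\<not> involves j (F i)"
  shows "exchange_const F i j = laurent_of (F i)"
  unfolding exchange_const_def laurent_of_def by (rule peval_cong) (use assms in auto)

text \<open>Choose for \<open>A_i\<close> the value that makes F_i, hence the constant, vanish. The
  substituted F_j then turns into F_j at X_i = 0, and as F_j does not contain \<open>A_i\<close>
  nothing else changes. Divisibility would make this 0, that is, X_i would divide F_j.\<close>

lemma exchange_not_dvd_old:
  assumes "\<not> involves j (F i)" "coeffs_free i (F j)" "\<not> var i dvd F j"
  shows "\<not> exchange_const F i j dvd exchange_subst F i j"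
proof
  assume dvd: "exchange_const F i j dvd exchange_subst F i j"
  let ?PM = "(\<Prod>r\<in>set s. AL r) * (\<Prod>\<rho>\<in>UNIV - set s - {i}. var \<rho>) :: 'n laurent"
  obtain w :: "'n laurent" where w: "last_var s * w = 1"
    using last_var_unit[of s] by (metis dvdE)
  let ?a = "AL(i := - (?PM * w))"
  have "subA ?a (laurent_of (F i)) = ?PM - ?PM * w * last_var s"
    using i by (simp add: Fi subA_laurent_of evalAX_exchange_poly prod_fun_upd last_var_def del: fun_upd_apply) (simp add: fun_upd_same)
  then have const: "subA ?a (exchange_const F i j) = 0"
    using w by (simp add: exchange_const_old[OF assms(1)] mult.assoc mult.commute[of w])
  have "subA ?a (exchange_subst F i j) = 0"
    using comm_ring_hom.hom_dvd[OF comm_ring_hom_subA dvd, of ?a] const by simp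
  moreover have "subA ?a (exchange_subst F i j) = evalAX ?a (var(i := 0)) (F j)"
    unfolding exchange_subst_def subA_peval
    by (rule arg_cong[of _ _ "\<lambda>v. evalAX ?a v (F j)"])
      (auto simp: comm_ring_hom.hom_mult[OF comm_ring_hom_subA] const subA_var)
  moreover have "evalAX ?a (var(i := 0)) (F j) = evalAX AL (var(i := 0)) (F j)"
    by (rule evalAX_coeffs_free[OF assms(2)])
  moreover have "evalAX AL (var(i := 0)) (F j) = laurent_of (evalAX AL (var(i := 0)) (F j))"
  proof -
    have "(\<lambda>l. laurent_of ((var(i := 0)) l)) = var(i := 0)"
      by (auto simp: laurent_of_simps)
    then show ?thesis
      unfolding evalAX_def evalA_AL hom_peval[OF comm_ring_hom_laurent_of] by simp
  qed
  ultimately have "evalAX AL (var(i := 0)) (F j) = (0 :: 'n pol)" by simp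
  \<comment> \<open>Setting X_i to 0 does not change a polynomial modulo X_i.\<close>
  moreover have "var i dvd p - evalAX AL (var(i := 0)) p" for p :: "'n pol"
    by (induction p rule: pol_induct)
      (auto simp: evalAX_simps evalA_AL dvd_diff_mult dvd_diff_add)
  ultimately show False using assms(3) by (metis diff_zero)
qed

end

section \<open>Units, products of primes and the exchange polynomial at the last mutated
  index\<close>

lemma unit_mult:
  fixes u :: "'a::comm_semiring_1"
  shows "u dvd 1 \<Longrightarrow> v dvd 1 \<Longrightarrow> u * v dvd 1"
  using mult_dvd_mono[of u 1 v 1] by simp

lemma unit_prod:
  fixes f :: "'i \<Rightarrow> 'a::comm_semiring_1"
  shows "(\<And>x. x \<in> I \<Longrightarrow> f x dvd 1) \<Longrightarrow> prod f I dvd 1"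
  by (induction I rule: infinite_finite_induct) (auto intro: unit_mult)

lemma prime_elem_unit_mult:
  fixes u :: "'a::idom"
  assumes "prime_elem p" "u dvd 1"
  shows "prime_elem (u * p)"
  using assms by (auto simp: prime_elem_def unit_mult_dvd_iff)

lemma dvd_prod_primes_unit:
  fixes D :: "'i \<Rightarrow> 'a::idom"
  assumes "finite S" "\<And>r. r \<in> S \<Longrightarrow> prime_elem (D r)" "\<And>r. r \<in> S \<Longrightarrow> \<not> D r dvd p" "p dvd (\<Prod>r\<in>S. D r)"
  shows "p dvd 1"
  using assms
proof (induction S rule: finite_induct)
  case (insert x S)
  have "p dvd (\<Prod>r\<in>S. D r) "
  proof -
    obtain q where q: "D x * (\<Prod>r\<in>S. D r) = p * q"
      using insert.prems(3) insert.hyps by (auto simp: dvd_def)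
    then have "D x dvd p * q" by (metis dvd_triv_left)
    then have "D x dvd q" using insert.prems(1,2) prime_elem_dvd_multD by blast
    then obtain r where "q = D x * r" by (auto simp: dvd_def)
    then have "D x * (\<Prod>r\<in>S. D r) = D x * (p * r)" using q by (simp add: ac_simps)
    moreover have "D x \<noteq> 0" using insert.prems(1)[of x] by auto
    ultimately have "(\<Prod>r\<in>S. D r) = p * r" by simp
    then show ?thesis by simp
  qed
  then show ?case using insert by auto
qed simp

text \<open>
  The exchange polynomial at \<open>j\<close> after the mutations at \<open>s\<close>, \<open>j\<close> and \<open>i\<close>.
\<close>

definition second_poly :: "'n::{finite,linorder} list \<Rightarrow> 'n \<Rightarrow> 'n \<Rightarrow> 'n pol" where
  "second_poly s j i =
    (\<Prod>r\<in>set s. AL r)\<^sup>2 * (\<Prod>\<rho>\<in>UNIV - set s - {j} - {i}. var \<rho>)\<^sup>2 + last_var s * var i"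

lemma evalAX_second_poly:
  "evalAX a v (second_poly s j i) =
    (\<Prod>r\<in>set s. a r)\<^sup>2 * (\<Prod>\<rho>\<in>UNIV - set s - {j} - {i}. v \<rho>)\<^sup>2 + (if s = [] then 1 else v (last s)) * v i"
  by (simp add: second_poly_def last_var_def evalAX_simps)

lemma laurent_of_second_poly:
  "laurent_of (second_poly s j i) =
    (\<Prod>r\<in>set s. AL r)\<^sup>2 * (\<Prod>\<rho>\<in>UNIV - set s - {j} - {i}. var \<rho>)\<^sup>2 + last_var s * var i"
  by (simp add: second_poly_def laurent_of_simps laurent_of_last_var)

lemma not_var_dvd_second_poly: "\<not> var l dvd second_poly s j i"
proof
  assume dvd: "var l dvd second_poly s j i"
  let ?v = "(\<lambda>_. 1)(l := 0 :: rat)"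
  have "evalAX (\<lambda>_. 1) ?v (second_poly s j i) = 0"
    using comm_ring_hom.hom_dvd[OF comm_ring_hom_evalAX dvd, of "\<lambda>_. 1" ?v] by (simp add: evalAX_simps)
  moreover have "(\<Prod>\<rho>\<in>UNIV - set s - {j} - {i}. ?v \<rho>)\<^sup>2 \<ge> 0" by simp
  moreover have "(\<Prod>\<rho>\<in>UNIV - set s - {j} - {i}. ?v \<rho>) = 1" if "(s \<noteq> [] \<and> l = last s) \<or> l = i"
    using that by (intro prod.neutral) auto
  ultimately show False by (auto simp: evalAX_second_poly split: if_splits)
qed

text \<open>The polynomial is linear in the \<open>i\<close>-th variable with the unit
  \<open>last_var s\<close> as leading coefficient, so this variable is eliminated instead of a
  coefficient. Its value is nonzero, as \<open>laurent_primeI\<close> demands.\<close>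

lemma prime_second_poly:
  assumes "i \<notin> set s"
  shows "prime_elem (laurent_of (second_poly s j i))"
proof -
  let ?PM = "(\<Prod>r\<in>set s. AL r)\<^sup>2 * (\<Prod>\<rho>\<in>UNIV - set s - {j} - {i}. var \<rho>)\<^sup>2 :: 'a laurent"
  obtain w :: "'a laurent" where w: "last_var s * w = 1"
    using last_var_unit[of s] by (metis dvdE)
  have last: "s \<noteq> [] \<Longrightarrow> last s \<noteq> i" using assms by auto
  have w0: "w \<noteq> 0" using w by auto
  have AL0: "(AL r :: 'a laurent) \<noteq> 0" for r using prime_AL[of r] by auto
  show ?thesis
  proof (rule laurent_primeI[where a = AL and v = "var(i := - (?PM * w))"])
    fix l
    have "var i + ?PM * w = laurent_of (second_poly s j i) * w"
      using w by (simp add: laurent_of_second_poly algebra_simps)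
    then show "laurent_of (second_poly s j i) dvd var l - (var(i := - (?PM * w))) l" by auto
    show "(var(i := - (?PM * w))) l \<noteq> 0"
      by (simp add: w0 AL0 laurent_var_nonzero)
  next
    have "evalAX AL (var(i := - (?PM * w))) (second_poly s j i) = ?PM - ?PM * w * last_var s"
      using last by (simp add: evalAX_second_poly prod_fun_upd last_var_def del: fun_upd_apply) (auto simp: algebra_simps)
    then show "evalAX AL (var(i := - (?PM * w))) (second_poly s j i) = 0"
      using w by (simp add: mult.assoc mult.commute[of w])
    show "second_poly s j i \<noteq> 0" using not_var_dvd_second_poly[of undefined s j i] by auto
  qed simp
qed

section \<open>Existence and shape of the mutated exchange polynomials\<close>

context
  fixes F :: "'n::{finite,linorder} \<Rightarrow> 'n pol" and s :: "'n list" and i :: 'n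
  assumes i: "i \<notin> set s" and Fi: "F i = exchange_poly s i" and hat: "hat F i = laurent_of (F i)"
begin

lemma mutated_poly_new:
  assumes j: "j \<notin> set s" "j \<noteq> i" and Fj: "F j = exchange_poly s j"
  shows "mutated_poly F i j (exchange_poly (s @ [i]) j)"
proof -
  \<comment> \<open>The exponent of X_i / Y_s, which cancels the factor found in
    \<open>exchange_subst_new\<close>.\<close>
  define m :: "'n \<Rightarrow>\<^sub>0 int" where
    "m = Poly_Mapping.single i 1 - (if s = [] then 0 else Poly_Mapping.single (last s) 1)"
  have "Poly_Mapping.single m 1 * last_var s = (var i :: 'n laurent)"
    by (simp add: m_def last_var_def var_def mult_single)
  moreover have "(Poly_Mapping.single m 1 * exchange_subst F i j) * last_var s
      = (Poly_Mapping.single m 1 * last_var s) * exchange_subst F i j"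
    by (simp only: mult_ac)
  ultimately have "(Poly_Mapping.single m 1 * exchange_subst F i j) * last_var s = var i * exchange_subst F i j"
    by (simp only:)
  then have "laurent_of (exchange_poly (s @ [i]) j) * last_var s
      = (Poly_Mapping.single m 1 * exchange_subst F i j) * last_var s"
    by (simp only: exchange_subst_new[where F = F, OF i Fi j Fj])
  moreover have "(last_var s :: 'n laurent) \<noteq> 0" by (auto simp: last_var_def laurent_var_nonzero)
  ultimately have "laurent_of (exchange_poly (s @ [i]) j) = Poly_Mapping.single m 1 * exchange_subst F i j"
    by (metis mult_right_cancel)
  moreover have "Poly_Mapping.lookup m j = 0"
  proof -
    have "s = [] \<or> last s \<noteq> j" using j last_in_set by blast
    then show ?thesis using j by (auto simp: m_def lookup_minus lookup_single when_def)
  qed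
  ultimately show ?thesis
    unfolding mutated_poly_iff[of F, OF hat]
    by (intro exI[of _ "exchange_subst F i j"] exI[of _ m] conjI allI impI divide_out.refl
        not_var_dvd_exchange_poly exchange_coprime_new[where F = F, OF i Fi j Fj])
qed

text \<open>Whatever is divided out, the result is associated with \<open>G\<close>, hence with the
  expected polynomial. Neither polynomial is divisible by a variable, so they differ by a unit of
  the coefficient ring only.\<close>

lemma mutated_poly_new_unique:
  assumes j: "j \<notin> set s" "j \<noteq> i" and Fj: "F j = exchange_poly s j" and P: "mutated_poly F i j P"
  shows "P = exchange_poly (s @ [i]) j \<or> P = - exchange_poly (s @ [i]) j"
proof -
  let ?C = "exchange_const F i j" and ?G = "exchange_subst F i j" and ?E = "exchange_poly (s @ [i]) j"
  from P obtain H m where H: "divide_out i j ?C ?G H" "laurent_of P = Poly_Mapping.single m 1 * H"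
      "\<And>l. \<not> var l dvd P"
    unfolding mutated_poly_iff[of F, OF hat] by blast
  have "?C \<noteq> 0"
    using prime_AL[of i] by (auto simp: exchange_const_new[where F = F, OF i Fi j] last_var_def laurent_var_nonzero)
  then obtain q where q: "?G = q * H" using H(1) divide_out_dvd by blast
  have "?G dvd H" by (rule divide_out_coprime_dvd[OF H(1)]) (rule exchange_coprime_new[where F = F, OF i Fi j Fj])
  then obtain r where r: "H = ?G * r" by (auto simp: dvd_def)
  have "H \<noteq> 0"
  proof
    assume "H = 0"
    then have "P = 0" using H(2) by simp
    then show False using H(3) by simp
  qed
  moreover have "H = H * (q * r)" using q r by (simp add: ac_simps)
  ultimately have "q * r = 1" by simp
  then have r_unit: "r dvd 1" by (metis dvd_triv_right)
  have "?G = (ivar i * last_var s) * laurent_of ?E"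
  proof -
    have "(ivar i * last_var s) * laurent_of ?E = ivar i * (laurent_of ?E * last_var s)" by (simp only: mult_ac)
    also have "\<dots> = ivar i * (var i * ?G)" by (simp only: exchange_subst_new[where F = F, OF i Fi j Fj])
    also have "\<dots> = (var i * ivar i) * ?G" by (simp only: mult_ac)
    finally show ?thesis by (simp add: var_ivar)
  qed
  then have eq: "laurent_of P = (Poly_Mapping.single m 1 * r * (ivar i * last_var s)) * laurent_of ?E"
    by (simp add: H(2) r ac_simps)
  have "Poly_Mapping.single m 1 * r * (ivar i * last_var s) dvd 1"
    by (intro unit_mult laurent_monomial_unit r_unit laurent_ivar_unit last_var_unit)
  then obtain k c where kc: "Poly_Mapping.single m 1 * r * (ivar i * last_var s) = Poly_Mapping.single k c" "c dvd 1"
    by (rule laurent_unitE)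
  have "P = const c * ?E"
    by (rule laurent_normal_unique[where m = k, OF _ H(3) not_var_dvd_exchange_poly]) (use eq kc(1) in simp)
  then show ?thesis
    using coeffs_unit[OF kc(2)] by (auto simp: const_simps)
qed

text \<open>As X_j does not occur in F_i, the constant is F_i itself, a prime not dividing
  \<open>G\<close>. So nothing has to be divided out, and the result is \<open>G\<close>, a prime by
  \<open>prime_elem_exchange\<close>, up to a monomial.\<close>

lemma mutated_poly_old:
  assumes j: "\<not> involves j (F i)" "\<not> involves j (F j)" and free: "coeffs_free i (F j)"
    and prime: "prime_elem (laurent_of (F j))" and var: "\<And>l. \<not> var l dvd F j"
  obtains P where "mutated_poly F i j P" "prime_elem (laurent_of P)" "\<And>l. \<not> var l dvd P" "\<not> involves j P"
proof -
  let ?C = "exchange_const F i j" and ?G = "exchange_subst F i j"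
  have C: "?C = laurent_of (F i)" by (rule exchange_const_old[where F = F, OF i Fi j(1)])
  have C_prime: "prime_elem ?C" unfolding C Fi by (rule prime_exchange_poly[OF i])
  have ndvd: "\<not> ?C dvd ?G" by (rule exchange_not_dvd_old[where F = F, OF i Fi j(1) free var])
  have "prime_elem ?G"
  proof (rule prime_elem_exchange[OF prime C_prime _ ndvd to_fract_exchange_subst])
    show "\<not> laurent_of (F j) dvd ?C"
      unfolding C Fi using prime by (intro coeffs_free_not_dvd_exchange_poly[OF i free]) (auto simp: prime_elem_def)
    have i_Fi: "\<not> involves i (F i)" unfolding Fi using i by (intro not_involves_exchange_poly) auto
    show "lsubst (lvar(i := to_fract ?C / lvar i)) ?C = to_fract ?C"
      unfolding C lsubst_laurent_of
      unfolding laurent_of_def hom_peval[OF comm_ring_hom_to_fract]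
      by (rule peval_cong) (use i_Fi in \<open>auto simp: lvar_def\<close>)
  qed
  moreover have "?G \<noteq> 0" using ndvd by auto
  then obtain P m where P: "laurent_of P = Poly_Mapping.single m 1 * ?G" "\<And>l. \<not> var l dvd P"
      "\<And>j. \<not> involves j ?G \<Longrightarrow> Poly_Mapping.lookup m j = 0"
    using laurent_normalize by blast
  ultimately have "prime_elem (laurent_of P)"
    by (simp add: prime_elem_unit_mult laurent_monomial_unit)
  moreover have jG: "\<not> involves j ?G"
  proof (cases "j = i")
    case True
    then have "?G = laurent_of (F j)"
      unfolding exchange_subst_def laurent_of_def by (intro peval_cong) (use j in auto)
    then show ?thesis using j by simp
  next
    case False
    then show ?thesis
      unfolding exchange_subst_def C
      by (intro not_involves_peval) (use j in \<open>auto simp: not_involves_mult\<close>)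
  qed
  moreover have "\<not> involves j (laurent_of P)"
    unfolding P(1) by (rule not_involves_mult[OF _ jG]) (simp add: involves_single P(3)[OF jG])
  moreover have "mutated_poly F i j P"
    unfolding mutated_poly_iff[of F, OF hat]
  proof (intro exI[of _ ?G] exI[of _ m] conjI allI impI)
    fix p assume "laurent_of p dvd ?C" "laurent_of p dvd ?G"
    then show "laurent_of p dvd 1"
      by (rule coprime_if_prime[OF C_prime mult_1_right[symmetric] dvd_refl ndvd])
  qed (rule divide_out.refl P(3)[OF jG] P(1,2))+
  ultimately show ?thesis using that P(2) by simp
qed

lemma exchange_const_last:
  assumes s: "s = s0 @ [j]"
  shows "exchange_const F i j = (\<Prod>r\<in>set s. AL r) * (\<Prod>\<rho>\<in>UNIV - set s - {i}. var \<rho>)"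
  by (simp add: exchange_const_def Fi s peval_const_eq_evalAX evalAX_exchange_poly prod_fun_upd del: fun_upd_apply)
    (simp add: fun_upd_same)

text \<open>X_j now stands for Y_s, so setting it to 0 leaves the first term A_j P M of F_i, where P
  and M are the products in the proof. Put into F_j = P M X_i + A_j Y_s0 this yields P M a second
  time: hence the squares in \<open>second_poly\<close> and the common factor
  \<open>A_j\<close>.\<close>

lemma exchange_subst_last:
  assumes s: "s = s0 @ [j]" "j \<notin> set s0" and Fj: "F j = exchange_poly s0 j"
  shows "exchange_subst F i j = AL j * (ivar i * laurent_of (second_poly s0 j i))"
proof -
  have last: "s0 \<noteq> [] \<Longrightarrow> last s0 \<noteq> i" using i s by auto
  have U: "UNIV - set s - {i} = UNIV - set s0 - {j} - {i}" using s by auto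
  let ?P = "(\<Prod>r\<in>set s0. AL r) :: 'n laurent" and ?M = "(\<Prod>\<rho>\<in>UNIV - set s0 - {j} - {i}. var \<rho>) :: 'n laurent"
  have C: "exchange_const F i j = AL j * ?P * ?M"
    unfolding exchange_const_last[OF s(1)] U using s by simp
  have "i \<in> UNIV - set s0 - {j}" using i s by auto
  then have "exchange_subst F i j = ?P * (exchange_const F i j * ivar i * ?M) + AL j * last_var s0"
    using last by (simp add: exchange_subst_def Fj peval_const_eq_evalAX
        evalAX_exchange_poly prod_fun_upd del: fun_upd_apply) (auto simp: last_var_def)
  also have "\<dots> = AL j * (ivar i * (?P\<^sup>2 * ?M\<^sup>2) + last_var s0)"
    by (simp add: C algebra_simps power2_eq_square)
  also have "\<dots> = AL j * (ivar i * (?P\<^sup>2 * ?M\<^sup>2) + (var i * ivar i) * last_var s0)"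
    by (simp add: var_ivar)
  also have "\<dots> = AL j * (ivar i * laurent_of (second_poly s0 j i))"
    unfolding laurent_of_second_poly by (simp only: distrib_left mult_ac)
  finally show ?thesis .
qed

text \<open>Here the single factor \<open>A_j\<close> is divided out. After that, a common divisor
  divides a product of primes \<open>A_r\<close> up to a unit, while none of these divides
  \<open>second_poly\<close>: at A_r = 0 and all other indeterminates 1 its value is a square plus
  1.\<close>

lemma mutated_poly_last:
  assumes s: "s = s0 @ [j]" "j \<notin> set s0" and Fj: "F j = exchange_poly s0 j"
  shows "mutated_poly F i j (second_poly s0 j i)"
  unfolding mutated_poly_iff[of F, OF hat]
proof (intro exI[of _ "ivar i * laurent_of (second_poly s0 j i)"] exI[of _ "Poly_Mapping.single i 1"] conjI allI impI)
  let ?C = "exchange_const F i j" and ?H = "ivar i * laurent_of (second_poly s0 j i)"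
  have "divide_out i j ?C (laurent_of (const (var j)) * ?H) ?H"
  proof (rule divide_out.step[OF _ _ _ divide_out.refl])
    have "(AL j :: 'n laurent) dvd (\<Prod>r\<in>set s. AL r)" by (rule dvd_prodI) (auto simp: s)
    then show "laurent_of (const (var j)) dvd ?C" by (simp add: exchange_const_last[OF s(1)])
  qed simp_all
  then show "divide_out i j ?C (exchange_subst F i j) ?H"
    by (simp add: exchange_subst_last[OF s Fj])
  show "Poly_Mapping.lookup (Poly_Mapping.single i (1 :: int)) j = 0"
    using i s by (auto simp: lookup_single when_def)
  have "Poly_Mapping.single (Poly_Mapping.single i (1 :: int)) (1 :: 'n coeffs) * ?H = (var i * ivar i) * laurent_of (second_poly s0 j i)"
    by (simp add: var_def mult.assoc)
  then show "laurent_of (second_poly s0 j i) = Poly_Mapping.single (Poly_Mapping.single i 1) 1 * ?H"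
    by (simp add: var_ivar)
  show "\<not> var l dvd second_poly s0 j i" for l by (rule not_var_dvd_second_poly)
  fix p assume p: "laurent_of p dvd ?C" "laurent_of p dvd ?H"
  have "(\<Prod>\<rho>\<in>UNIV - set s - {i}. var \<rho> :: 'n laurent) dvd 1" by (intro unit_prod laurent_var_unit)
  then have "laurent_of p dvd (\<Prod>r\<in>set s. AL r)"
    using p(1) by (simp add: exchange_const_last[OF s(1)] mult.commute[of "prod AL _"] dvd_unit_mult_iff)
  moreover have "\<not> AL r dvd laurent_of p" for r
  proof
    assume "AL r dvd laurent_of p"
    then have "AL r dvd ?H" using p(2) by (rule dvd_trans)
    then have "AL r dvd laurent_of (second_poly s0 j i)"
      by (simp only: dvd_unit_mult_iff[OF laurent_ivar_unit])
    then have "valA ((\<lambda>_. 1)(r := 0)) (AL r) dvd valA ((\<lambda>_. 1)(r := 0)) (laurent_of (second_poly s0 j i))"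
      by (rule comm_ring_hom.hom_dvd[OF comm_ring_hom_valA])
    then have "(\<Prod>x\<in>set s0. ((\<lambda>_. 1)(r := 0 :: rat)) x)\<^sup>2 + 1 = 0"
      by (simp add: valA_const evalA_var valA_laurent_of evalAX_second_poly)
    moreover have "(\<Prod>x\<in>set s0. ((\<lambda>_. 1)(r := 0 :: rat)) x)\<^sup>2 \<ge> 0" by simp
    ultimately show False by linarith
  qed
  ultimately show "laurent_of p dvd 1"
    using prime_AL by (intro dvd_prod_primes_unit[of "set s" AL]) auto
qed

text \<open>\<open>A_\<tau>\<close> is absent from F_i and F_j, hence from \<open>G\<close>. Any
  result of dividing out is a divisor of the nonzero \<open>G\<close>, so
  \<open>coeffs_free_divisor\<close> applies without knowing which factors were removed.\<close>

lemma mutated_poly_coeffs_free: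
  assumes P: "mutated_poly F i j P" and "\<tau> \<noteq> i" "\<tau> \<notin> set s" and free: "coeffs_free \<tau> (F j)"
    and nz: "exchange_const F i j \<noteq> 0"
  shows "coeffs_free \<tau> P"
proof -
  let ?C = "exchange_const F i j" and ?G = "exchange_subst F i j"
  from P obtain H m where H: "divide_out i j ?C ?G H" "laurent_of P = Poly_Mapping.single m 1 * H"
      "\<And>l. \<not> var l dvd P"
    unfolding mutated_poly_iff[of F, OF hat] by blast
  obtain q where q: "q \<noteq> 0" "?G = q * H" using H(1) nz by (rule divide_out_dvd)
  have "H \<noteq> 0"
  proof
    assume "H = 0"
    then have "P = 0" using H(2) by simp
    then show False using H(3) by simp
  qed
  then have "?G \<noteq> 0" using q by simp
  have C: "coeffs_free \<tau> ?C"
    unfolding exchange_const_def Fi using assms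
    by (intro coeffs_free_peval coeffs_free_exchange_poly) (auto intro: coeffs_free_intros simp: coeffs_free_def[of _ 0])
  have "coeffs_free \<tau> ?G"
    unfolding exchange_subst_def using free C
    by (intro coeffs_free_peval) (auto intro!: coeffs_free_intros)
  then have "coeffs_free \<tau> H"
    using \<open>?G \<noteq> 0\<close> unfolding q(2) by (subst (asm) (1 2) mult.commute) (rule coeffs_free_divisor)
  then have "coeffs_free \<tau> (laurent_of P)"
    unfolding H(2) by (intro coeffs_free_mult coeffs_free_monomial)
  then show ?thesis by simp
qed

end

section \<open>Exchange of a transcendence basis\<close>

abbreviation "\<kappa> \<equiv> (\<lambda>r. to_fract (const r)) :: 'n::{finite,linorder} coeffs fract \<Rightarrow> 'n ratfun"

lemma comm_ring_hom_\<kappa>: "comm_ring_hom \<kappa>"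
  by (rule comm_ring_hom_comp[OF comm_ring_hom_to_fract comm_ring_hom_const])

lemma comm_ring_hom_coeff_in_ratfun: "comm_ring_hom coeff_in_ratfun"
  unfolding coeff_in_ratfun_def by (rule comm_ring_hom_comp[OF comm_ring_hom_\<kappa> comm_ring_hom_to_fract])

lemma peval_X: "peval \<kappa> X p = to_fract p"
  by (rule pol_hom_eqI[OF comm_ring_hom_peval[OF comm_ring_hom_\<kappa>] comm_ring_hom_to_fract])
    (simp_all add: peval_const peval_var comm_ring_hom_\<kappa> X_def)

text \<open>Exchange polynomials have coefficients in R, whereas a transcendence basis is tested
  with polynomials over Frac(R); this is the passage between them.\<close>

definition fract_coeffs :: "'n::{finite,linorder} pol \<Rightarrow> ('n \<Rightarrow>\<^sub>0 nat) \<Rightarrow>\<^sub>0 'n coeffs fract" where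
  "fract_coeffs = peval (\<lambda>r. const (to_fract r)) var"

lemma lookup_fract_coeffs: "Poly_Mapping.lookup (fract_coeffs p) m = to_fract (Poly_Mapping.lookup p m)"
proof -
  have eq: "fract_coeffs p = (\<Sum>k\<in>Poly_Mapping.keys p. Poly_Mapping.single k (to_fract (Poly_Mapping.lookup p k)))"
    unfolding fract_coeffs_def peval_def
  proof (intro sum.cong refl)
    fix k :: "'a \<Rightarrow>\<^sub>0 nat"
    have "(\<Prod>i\<in>UNIV. var i ^ Poly_Mapping.lookup k i) = Poly_Mapping.single k (1 :: 'a coeffs fract)"
      by (subst monomial_eq_prod) (simp add: var_power)
    then show "const (to_fract (Poly_Mapping.lookup p k)) * (\<Prod>i\<in>UNIV. var i ^ Poly_Mapping.lookup k i)
        = Poly_Mapping.single k (to_fract (Poly_Mapping.lookup p k))"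
      by (simp flip: single_eq_const_mult)
  qed simp_all
  have "Poly_Mapping.lookup (fract_coeffs p) m
      = (\<Sum>k\<in>Poly_Mapping.keys p. if k = m then to_fract (Poly_Mapping.lookup p m) else 0)"
    unfolding eq lookup_sum by (intro sum.cong) (auto simp: lookup_single)
  then show ?thesis by (auto simp: sum.delta in_keys_iff)
qed

lemma fract_coeffs_eq_0_iff: "fract_coeffs p = 0 \<longleftrightarrow> p = 0"
  by (simp add: poly_mapping_eq_iff fun_eq_iff lookup_fract_coeffs)

lemma involves_fract_coeffs: "involves i (fract_coeffs p) \<longleftrightarrow> involves i p"
proof -
  have "Poly_Mapping.keys (fract_coeffs p) = Poly_Mapping.keys p"
    by (auto simp: in_keys_iff lookup_fract_coeffs)
  then show ?thesis by (simp add: involves_def)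
qed

lemma peval_fract_coeffs: "peval \<kappa> x (fract_coeffs p) = peval coeff_in_ratfun x p"
  unfolding fract_coeffs_def hom_peval[OF comm_ring_hom_peval[OF comm_ring_hom_\<kappa>]]
  by (simp add: peval_const peval_var comm_ring_hom_\<kappa> coeff_in_ratfun_def[abs_def])

lemma peval_coeff_X_eq_0_iff: "peval coeff_in_ratfun X p = 0 \<longleftrightarrow> p = 0"
  by (simp add: peval_X fract_coeffs_eq_0_iff flip: peval_fract_coeffs)

lemma generating_transcendence_basis_X: "generating_transcendence_basis (X :: 'n::{finite,linorder} \<Rightarrow> 'n ratfun)"
  unfolding generating_transcendence_basis_def Let_def peval_X
proof (intro conjI allI)
  fix f :: "'n ratfun"
  show "\<exists>p q. to_fract q \<noteq> 0 \<and> f = to_fract p / to_fract q"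
    by (cases f) (metis Fract_conv_to_fract to_fract_eq_0_iff)
qed simp

lemma basis_nonzero:
  assumes "generating_transcendence_basis x"
  shows "x l \<noteq> 0"
proof
  assume "x l = 0"
  then have "peval \<kappa> x (var l) = 0" by (simp add: peval_var comm_ring_hom_\<kappa>)
  then have "(var l :: ('a \<Rightarrow>\<^sub>0 nat) \<Rightarrow>\<^sub>0 'a coeffs fract) = 0"
    using assms unfolding generating_transcendence_basis_def Let_def by blast
  then show False by (metis involves_var not_involves_zero)
qed

text \<open>\<open>N\<close> and \<open>q\<close> do not depend on \<open>v\<close>, so one identity
  can be used at the old basis, at the new one and at a generic point.\<close>

lemma peval_exchange_clear:
  fixes p C :: "('n::{finite,linorder} \<Rightarrow>\<^sub>0 nat) \<Rightarrow>\<^sub>0 'n coeffs fract"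
  obtains N q where "\<And>v. v i \<noteq> 0 \<Longrightarrow> peval \<kappa> v q = v i ^ N * peval \<kappa> (v(i := peval \<kappa> v C / v i)) p"
proof -
  have "\<exists>N q. \<forall>v. v i \<noteq> 0 \<longrightarrow> peval \<kappa> v q = v i ^ N * peval \<kappa> (v(i := peval \<kappa> v C / v i)) p"
  proof (induction p rule: pol_induct)
    case (const r)
    show ?case
      by (rule exI[of _ 0], rule exI[of _ "const r"]) (simp add: peval_const comm_ring_hom_\<kappa>)
  next
    case (var l)
    show ?case
      by (rule exI[of _ "if l = i then 1 else 0"], rule exI[of _ "if l = i then C else var l"])
        (simp add: peval_var comm_ring_hom_\<kappa>)
  next
    case (add p q)
    then obtain M a N b where
      "\<And>v. v i \<noteq> 0 \<Longrightarrow> peval \<kappa> v a = v i ^ M * peval \<kappa> (v(i := peval \<kappa> v C / v i)) p"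
      "\<And>v. v i \<noteq> 0 \<Longrightarrow> peval \<kappa> v b = v i ^ N * peval \<kappa> (v(i := peval \<kappa> v C / v i)) q" by blast
    then show ?case
      by (intro exI[of _ "M + N"] exI[of _ "var i ^ N * a + var i ^ M * b"])
        (simp add: comm_ring_hom.hom_simps[OF comm_ring_hom_peval[OF comm_ring_hom_\<kappa>]]
          peval_var comm_ring_hom_\<kappa> power_add algebra_simps del: fun_upd_apply)
  next
    case (mult p q)
    then obtain M a N b where
      "\<And>v. v i \<noteq> 0 \<Longrightarrow> peval \<kappa> v a = v i ^ M * peval \<kappa> (v(i := peval \<kappa> v C / v i)) p"
      "\<And>v. v i \<noteq> 0 \<Longrightarrow> peval \<kappa> v b = v i ^ N * peval \<kappa> (v(i := peval \<kappa> v C / v i)) q" by blast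
    then show ?case
      by (intro exI[of _ "M + N"] exI[of _ "a * b"])
        (simp add: comm_ring_hom.hom_simps[OF comm_ring_hom_peval[OF comm_ring_hom_\<kappa>]] power_add algebra_simps
          del: fun_upd_apply)
  qed
  then show ?thesis using that by metis
qed

lemma generating_transcendence_basis_exchange:
  fixes x :: "'n::{finite,linorder} \<Rightarrow> 'n ratfun"
  assumes x: "generating_transcendence_basis x" and F: "\<not> involves i F" "F \<noteq> 0"
  shows "generating_transcendence_basis (x(i := peval coeff_in_ratfun x F / x i))"
proof -
  define C where "C = fract_coeffs F"
  let ?ev = "peval \<kappa>"
  define x' where "x' = x(i := ?ev x C / x i)"
  have C: "C \<noteq> 0" "\<not> involves i C"
    using F by (simp_all add: C_def fract_coeffs_eq_0_iff involves_fract_coeffs)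
  have indep: "p = 0" if "?ev x p = 0" for p
    using x that unfolding generating_transcendence_basis_def Let_def by blast
  have gen: "\<exists>p q. ?ev x q \<noteq> 0 \<and> f = ?ev x p / ?ev x q" for f
    using x unfolding generating_transcendence_basis_def Let_def by blast
  have x0: "x l \<noteq> 0" for l by (rule basis_nonzero[OF x])
  have C_upd: "?ev (v(i := t)) C = ?ev v C" for v t
    by (rule peval_cong) (use C in auto)
  have Cx: "?ev x C \<noteq> 0" using indep C by blast
  have "x' i \<noteq> 0" using Cx x0 by (simp add: x'_def)
  have restore: "x'(i := ?ev x' C / x' i) = x"
    using Cx x0 by (auto simp: x'_def C_upd)
  have "p = 0" if p: "?ev x' p = 0" for p
  proof -
    obtain N q where q: "\<And>v. v i \<noteq> 0 \<Longrightarrow> ?ev v q = v i ^ N * ?ev (v(i := ?ev v C / v i)) p"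
      by (rule peval_exchange_clear[where i = i and C = C and p = p]) (rule that)
    have "?ev x q = 0" using q[OF x0] p by (simp only: x'_def[symmetric] mult_zero_right)
    then have "q = 0" by (rule indep)
    \<comment> \<open>To come back from q = 0 to \<open>p\<close>, the identity is evaluated at the
      generic point exchanged once: exchanging again restores \<open>X\<close>, and there
      \<open>p\<close> evaluates to itself.\<close>
    define X' where "X' = X(i := to_fract C / X i)"
    have X0: "X i \<noteq> 0" by (rule basis_nonzero[OF generating_transcendence_basis_X])
    have "X' i \<noteq> 0" using C X0 by (simp add: X'_def)
    moreover have "X'(i := ?ev X' C / X' i) = X"
      using C X0 by (auto simp: X'_def C_upd peval_X)
    ultimately have "X' i ^ N * to_fract p = 0"
      using q[of X'] \<open>q = 0\<close> by (simp add: peval_X comm_ring_hom.hom_zero[OF comm_ring_hom_peval[OF comm_ring_hom_\<kappa>]])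
    then show "p = 0" using \<open>X' i \<noteq> 0\<close> by simp
  qed
  moreover have "\<exists>p q. ?ev x' q \<noteq> 0 \<and> f = ?ev x' p / ?ev x' q" for f
  proof -
    obtain p q where f: "?ev x q \<noteq> 0" "f = ?ev x p / ?ev x q" using gen by blast
    obtain M a where "\<And>v. v i \<noteq> 0 \<Longrightarrow> ?ev v a = v i ^ M * ?ev (v(i := ?ev v C / v i)) p"
      by (rule peval_exchange_clear[where i = i and C = C and p = p]) (rule that)
    then have a: "?ev x' a = x' i ^ M * ?ev x p" using \<open>x' i \<noteq> 0\<close> by (metis restore)
    obtain N b where "\<And>v. v i \<noteq> 0 \<Longrightarrow> ?ev v b = v i ^ N * ?ev (v(i := ?ev v C / v i)) q"
      by (rule peval_exchange_clear[where i = i and C = C and p = q]) (rule that)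
    then have b: "?ev x' b = x' i ^ N * ?ev x q" using \<open>x' i \<noteq> 0\<close> by (metis restore)
    show ?thesis
      using f \<open>x' i \<noteq> 0\<close>
      by (intro exI[of _ "var i ^ N * a"] exI[of _ "var i ^ M * b"])
        (simp add: a b comm_ring_hom.hom_simps[OF comm_ring_hom_peval[OF comm_ring_hom_\<kappa>]] peval_var comm_ring_hom_\<kappa>)
  qed
  ultimately have "generating_transcendence_basis x'"
    unfolding generating_transcendence_basis_def Let_def by blast
  then show ?thesis by (simp add: x'_def C_def peval_fract_coeffs)
qed

section \<open>The new cluster variables\<close>

text \<open>The numerator is kept as a formal polynomial because X_r can be set to 0 there, but not
  in the field of rational functions.\<close>

definition cluster_numerator :: "'n::{finite,linorder} set \<Rightarrow> 'n pol" where
  "cluster_numerator S = (\<Sum>i\<in>S. (\<Prod>j\<in>S - {i}. AL j) * (\<Prod>j\<in>UNIV - {i}. var j)) + (\<Prod>i\<in>S. AL i)"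

text \<open>Indexing by the underlying set builds in that the order of the sequence does not matter,
  which is one direction of the final equivalence.\<close>

definition cluster_var :: "'n::{finite,linorder} set \<Rightarrow> 'n ratfun" where
  "cluster_var S =
    ((\<Sum>i\<in>S. (\<Prod>j\<in>S - {i}. A j) * (\<Prod>j\<in>UNIV - {i}. X j)) + (\<Prod>i\<in>S. A i)) / (\<Prod>i\<in>S. X i)"

lemma X_nonzero: "X i \<noteq> 0"
  by (rule basis_nonzero[OF generating_transcendence_basis_X])

lemma peval_AL: "peval coeff_in_ratfun v (AL r) = A r"
  by (simp add: peval_const comm_ring_hom_coeff_in_ratfun A_def)

lemmas peval_ratfun_simps = comm_ring_hom.hom_simps[OF comm_ring_hom_peval[OF comm_ring_hom_coeff_in_ratfun]]
  peval_AL peval_var[OF comm_ring_hom_coeff_in_ratfun]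

lemma cluster_var_eq:
  "cluster_var S = peval coeff_in_ratfun X (cluster_numerator S) / peval coeff_in_ratfun X (\<Prod>i\<in>S. var i)"
  by (simp add: cluster_var_def cluster_numerator_def peval_ratfun_simps)

text \<open>At $X_r = 0$ and all other indeterminates 1, the numerator of a cluster variable is positive.\<close>

lemma cluster_var_subset:
  assumes "cluster_var S = cluster_var S'"
  shows "S \<subseteq> S'"
proof
  fix r assume "r \<in> S"
  show "r \<in> S'"
  proof (rule ccontr)
    assume "r \<notin> S'"
    let ?e = "peval coeff_in_ratfun X" and ?V = "\<lambda>S. (\<Prod>i\<in>S. var i) :: 'a pol"
    have "?e (?V S) \<noteq> 0" for S by (simp add: peval_ratfun_simps X_nonzero)
    then have "?e (cluster_numerator S) * ?e (?V S') = ?e (cluster_numerator S') * ?e (?V S)"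
      using assms by (simp add: cluster_var_eq frac_eq_eq)
    then have "?e (cluster_numerator S * ?V S' - cluster_numerator S' * ?V S) = 0"
      by (simp only: comm_ring_hom.hom_simps[OF comm_ring_hom_peval[OF comm_ring_hom_coeff_in_ratfun]]) simp
    then have eq: "cluster_numerator S * ?V S' = cluster_numerator S' * ?V S"
      by (simp only: peval_coeff_X_eq_0_iff eq_iff_diff_eq_0[symmetric])
    let ?v = "(\<lambda>_. 1)(r := 0 :: rat)"
    let ?f = "evalAX (\<lambda>_. 1) ?v"
    have "?f (?V S') = 1" using \<open>r \<notin> S'\<close> by (simp add: evalAX_simps prod_fun_upd del: fun_upd_apply)
    moreover have "?f (?V S) = 0" using \<open>r \<in> S\<close> by (simp add: evalAX_simps prod_fun_upd del: fun_upd_apply)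
    moreover have "?f (cluster_numerator S) = (\<Sum>i\<in>S. \<Prod>j\<in>UNIV - {i}. ?v j) + 1"
      by (simp add: cluster_numerator_def evalAX_simps)
    moreover have "(\<Sum>i\<in>S. \<Prod>j\<in>UNIV - {i}. ?v j) \<ge> 0" by (intro sum_nonneg prod_nonneg) auto
    ultimately show False
      using arg_cong[OF eq, of ?f] by (simp add: comm_ring_hom.hom_mult[OF comm_ring_hom_evalAX])
  qed
qed

lemma cluster_var_inject: "cluster_var S = cluster_var S' \<longleftrightarrow> S = S'"
  using cluster_var_subset[of S S'] cluster_var_subset[of S' S] by auto

text \<open>Over the common denominator the first summand is the new term of the sum at
  \<open>i\<close>, as the product of all X except X_i splits into \<open>M * d\<close>. The factor
  \<open>A_i\<close> before the old variable completes the old terms and the last product.\<close>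

lemma cluster_var_insert:
  assumes "i \<notin> S"
  shows "((\<Prod>r\<in>S. A r) * (\<Prod>\<rho>\<in>UNIV - S - {i}. X \<rho>) + A i * cluster_var S) / X i = cluster_var (insert i S)"
proof -
  have fin: "finite S" by simp
  define N where "N = (\<Sum>k\<in>S. (\<Prod>j\<in>S - {k}. A j) * (\<Prod>j\<in>UNIV - {k}. X j))"
  define a where "a = (\<Prod>r\<in>S. A r)"
  define d where "d = (\<Prod>r\<in>S. X r)"
  define M where "M = (\<Prod>\<rho>\<in>UNIV - S - {i}. X \<rho>)"
  have d: "d \<noteq> 0" by (simp add: d_def X_nonzero)
  have "(\<Prod>j\<in>UNIV - {i}. X j) = (\<Prod>j\<in>(UNIV - S - {i}) \<union> S. X j)"
    using assms by (intro prod.cong) auto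
  also have "\<dots> = M * d"
    unfolding M_def d_def by (intro prod.union_disjoint) auto
  finally have Xi: "(\<Prod>j\<in>UNIV - {i}. X j) = M * d" .
  have "(\<Sum>k\<in>S. (\<Prod>j\<in>insert i S - {k}. A j) * (\<Prod>j\<in>UNIV - {k}. X j))
      = (\<Sum>k\<in>S. A i * ((\<Prod>j\<in>S - {k}. A j) * (\<Prod>j\<in>UNIV - {k}. X j)))"
  proof (intro sum.cong refl)
    fix k assume "k \<in> S"
    then have "insert i S - {k} = insert i (S - {k})" using assms by auto
    then show "(\<Prod>j\<in>insert i S - {k}. A j) * (\<Prod>j\<in>UNIV - {k}. X j)
        = A i * ((\<Prod>j\<in>S - {k}. A j) * (\<Prod>j\<in>UNIV - {k}. X j))"
      using assms by (simp add: mult.assoc)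
  qed simp
  also have "\<dots> = A i * N" by (simp add: N_def sum_distrib_left)
  finally have sum: "(\<Sum>k\<in>S. (\<Prod>j\<in>insert i S - {k}. A j) * (\<Prod>j\<in>UNIV - {k}. X j)) = A i * N" .
  have "insert i S - {i} = S" using assms by auto
  then have "cluster_var (insert i S) = (a * (M * d) + A i * N + A i * a) / (X i * d)"
    using assms by (simp add: cluster_var_def sum Xi a_def d_def)
  moreover have "cluster_var S = (N + a) / d" by (simp add: cluster_var_def N_def a_def d_def)
  moreover have "(a * M + A i * ((N + a) / d)) / X i = (a * (M * d) + A i * N + A i * a) / (X i * d)"
    using d X_nonzero[of i] by (simp add: field_simps)
  ultimately show ?thesis by (simp only: a_def M_def)
qed

section \<open>The seeds along an activation sequence\<close>

text \<open>At \<open>last s\<close> the closed form carries \<open>butlast s\<close>, since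
  mutation at an index leaves the exchange polynomial attached to it unchanged. The last clause is
  what \<open>hat_exchange_poly\<close> uses at the earlier indices.\<close>

definition tau_inv :: "'n::{finite,linorder} list \<Rightarrow> 'n seed_data \<Rightarrow> bool" where
  "tau_inv s S \<longleftrightarrow> (case S of (x, F) \<Rightarrow>
     distinct s \<and> seed (x, F) \<and>
     (\<forall>j. j \<notin> set s \<longrightarrow> F j = exchange_poly s j \<and> x j = X j) \<and>
     (s \<noteq> [] \<longrightarrow> F (last s) = exchange_poly (butlast s) (last s) \<and> x (last s) = cluster_var (set s)) \<and>
     (\<forall>j\<in>set s. \<forall>\<tau>. \<tau> \<notin> set s \<longrightarrow> coeffs_free \<tau> (F j)))"

lemma tau_invD:
  assumes "tau_inv s (x, F)"
  shows "distinct s" "seed (x, F)" "\<And>j. j \<notin> set s \<Longrightarrow> F j = exchange_poly s j" "\<And>j. j \<notin> set s \<Longrightarrow> x j = X j"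
    "s \<noteq> [] \<Longrightarrow> F (last s) = exchange_poly (butlast s) (last s)" "s \<noteq> [] \<Longrightarrow> x (last s) = cluster_var (set s)"
    "\<And>j \<tau>. j \<in> set s \<Longrightarrow> \<tau> \<notin> set s \<Longrightarrow> coeffs_free \<tau> (F j)"
  using assms by (auto simp: tau_inv_def)

lemma seedD:
  assumes "seed (x, F)"
  shows "generating_transcendence_basis x" "irreducible (F i)" "\<not> var l dvd F i" "\<not> involves i (F i)"
  using assms by (auto simp: seed_def)

lemma initial_seed_eq: "initial_seed = (X, exchange_poly [])"
  by (simp add: initial_seed_def exchange_poly_def last_var_def fun_eq_iff add.commute)

lemma irreducible_exchange_poly: "\<sigma> \<notin> set s \<Longrightarrow> irreducible (exchange_poly s \<sigma>)"
  by (intro irreducible_if_laurent_prime prime_exchange_poly not_var_dvd_exchange_poly)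

lemma tau_inv_Nil: "tau_inv [] initial_seed"
  by (simp add: tau_inv_def initial_seed_eq seed_def generating_transcendence_basis_X
      irreducible_exchange_poly not_var_dvd_exchange_poly not_involves_exchange_poly)

lemma last_not_in_butlast: "distinct s \<Longrightarrow> s \<noteq> [] \<Longrightarrow> last s \<notin> set (butlast s)"
  by (cases s rule: rev_cases) auto

lemma hat_if_tau_inv:
  assumes inv: "tau_inv s (x, F)" and i: "i \<notin> set s"
  shows "hat F i = laurent_of (F i)"
proof (rule hat_exchange_poly[OF i])
  note D = tau_invD[OF inv]
  show "F i = exchange_poly s i" by (rule D(3)[OF i])
  show "\<not> laurent_of (F j) dvd 1" for j
    using seedD[OF D(2)] by (intro not_laurent_unit) (auto simp: irreducible_def)
  show "F j \<noteq> 0" for j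
    using seedD(2)[OF D(2), of j] by (auto simp: irreducible_def)
  show "F j = exchange_poly s j" if "j \<notin> set s" for j by (rule D(3)[OF that])
  show "\<exists>s'. F (last s) = exchange_poly s' (last s) \<and> last s \<notin> set s'" if "s \<noteq> []"
    using D(5)[OF that] last_not_in_butlast[OF D(1) that] by blast
  show "coeffs_free i (F j)" if "j \<in> set s" for j by (rule D(7)[OF that i])
qed

lemma exchange_const_nonzero:
  assumes inv: "tau_inv s (x, F)" and i: "i \<notin> set s" and j: "j \<in> set s"
  shows "exchange_const F i j \<noteq> 0"
proof (cases "j = last s")
  case True
  have s: "s = butlast s @ [j]" using True j by (cases s rule: rev_cases) auto
  have Fi: "F i = exchange_poly s i" by (rule tau_invD(3)[OF inv i])
  have "(AL r :: 'a laurent) \<noteq> 0" for r using prime_AL[of r] by auto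
  then show ?thesis
    by (simp add: exchange_const_last[where F = F, OF i Fi hat_if_tau_inv[OF inv i] s] laurent_var_nonzero)
next
  case False
  have Fi: "F i = exchange_poly s i" by (rule tau_invD(3)[OF inv i])
  have "\<not> involves j (F i)" unfolding Fi using j False by (intro not_involves_exchange_poly) auto
  then show ?thesis
    by (simp add: exchange_const_old[where F = F, OF i Fi]) (simp add: Fi exchange_poly_nonzero)
qed

lemma new_cluster_var:
  assumes inv: "tau_inv s (x, F)" and i: "i \<notin> set s"
  shows "leval coeff_in_ratfun x (hat F i) / x i = cluster_var (set (s @ [i]))"
proof -
  note D = tau_invD[OF inv]
  \<comment> \<open>For the empty sequence the formula gives 1, an empty sum plus an empty product
    over an empty product.\<close>
  have Y: "(if s = [] then 1 else x (last s)) = cluster_var (set s)"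
    using D(6) by (simp add: cluster_var_def)
  have "leval coeff_in_ratfun x (hat F i)
      = (\<Prod>r\<in>set s. A r) * (\<Prod>\<rho>\<in>UNIV - set s - {i}. x \<rho>) + A i * (if s = [] then 1 else x (last s))"
    by (simp add: hat_if_tau_inv[OF inv i] D(3)[OF i] leval_laurent_of exchange_poly_def last_var_def peval_ratfun_simps)
  also have "(\<Prod>\<rho>\<in>UNIV - set s - {i}. x \<rho>) = (\<Prod>\<rho>\<in>UNIV - set s - {i}. X \<rho>)"
    by (intro prod.cong) (auto simp: D(4))
  finally show ?thesis
    using cluster_var_insert[OF i] by (simp only: Y D(4)[OF i]) simp
qed

lemma tau_inv_mutation:
  assumes inv: "tau_inv s S" and i: "i \<notin> set s" and mut: "mutation i S S'"
    and sign: "\<forall>\<sigma>. \<sigma> \<notin> set (s @ [i]) \<longrightarrow> snd S' \<sigma> \<noteq> - reference_poly (s @ [i]) \<sigma>"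
  shows "tau_inv (s @ [i]) S'"
proof -
  obtain x F where S: "S = (x, F)" by (cases S)
  obtain x' F' where S': "S' = (x', F')" by (cases S')
  note inv = inv[unfolded S] and D = tau_invD[OF inv[unfolded S]] and hat = hat_if_tau_inv[OF inv[unfolded S] i]
  have Fi: "F i = exchange_poly s i" by (rule D(3)[OF i])
  have mut': "seed (x', F')" "x' = x(i := leval coeff_in_ratfun x (hat F i) / x i)"
      "\<And>j. involves i (F j) \<Longrightarrow> mutated_poly F i j (F' j)" "\<And>j. \<not> involves i (F j) \<Longrightarrow> F' j = F j"
    using mut by (auto simp: mutation_def S S' split: if_splits)
  have F'i: "F' i = exchange_poly s i"
    using mut'(4)[of i] seedD(4)[OF D(2), of i] Fi by simp
  have new: "F' j = exchange_poly (s @ [i]) j" if "j \<notin> set (s @ [i])" for j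
  proof -
    have j: "j \<notin> set s" "j \<noteq> i" using that by auto
    have "mutated_poly F i j (F' j)"
      using D(3)[OF j(1)] i j by (intro mut'(3)) (simp add: involves_exchange_poly)
    then have "F' j = exchange_poly (s @ [i]) j \<or> F' j = - exchange_poly (s @ [i]) j"
      by (rule mutated_poly_new_unique[where F = F, OF i Fi hat j D(3)[OF j(1)]])
    \<comment> \<open>The only use of the sign convention: it excludes the negative.\<close>
    then show ?thesis using sign that by (auto simp: S' reference_poly_eq)
  qed
  have free: "coeffs_free \<tau> (F' j)" if "j \<in> set (s @ [i])" "\<tau> \<notin> set (s @ [i])" for j \<tau>
  proof (cases "j = i")
    case True
    then show ?thesis using that F'i by (simp add: coeffs_free_exchange_poly)
  next
    case False
    then have j: "j \<in> set s" using that by simp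
    have "coeffs_free \<tau> (F j)" using D(7)[OF j] that by simp
    then show ?thesis
      using mut'(3,4)[of j] that
        mutated_poly_coeffs_free[where F = F, OF i Fi hat _ _ _ _ exchange_const_nonzero[OF inv i j], of "F' j" \<tau>]
      by (cases "involves i (F j)") auto
  qed
  show ?thesis
    using i mut'(1) new free F'i D(1,4) new_cluster_var[OF inv i]
    by (auto simp: tau_inv_def S' mut'(2) coeffs_free_exchange_poly)
qed

lemma tau_inv: "tau s S \<Longrightarrow> tau_inv s S"
  by (induction rule: tau.induct) (auto intro: tau_inv_Nil tau_inv_mutation)

text \<open>The induction is strengthened by Laurent primality, because the next mutation at an
  earlier index transports primality, whereas a seed only records irreducibility in the polynomial
  ring.\<close>

lemma tau_exists:
  assumes "distinct s"
  shows "\<exists>x F. tau s (x, F) \<and> (\<forall>j. prime_elem (laurent_of (F j)))"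
  using assms
proof (induction s rule: rev_induct)
  case Nil
  show ?case
    using tau.Nil unfolding initial_seed_eq
    by (intro exI[of _ X] exI[of _ "exchange_poly []"]) (simp add: prime_exchange_poly)
next
  case (snoc i s)
  then obtain x F where tau: "tau s (x, F)" and prime: "\<And>j. prime_elem (laurent_of (F j))" by auto
  have i: "i \<notin> set s" using snoc.prems by simp
  note inv = tau_inv[OF tau]
  note D = tau_invD[OF inv] and hat = hat_if_tau_inv[OF inv i]
  note seed = seedD[OF D(2)]
  have Fi: "F i = exchange_poly s i" by (rule D(3)[OF i])
  \<comment> \<open>One index at a time: the conditions on the new exchange polynomials do not
    couple different indices, so a choice at each \<open>j\<close> suffices.\<close>
  have "\<exists>P. (if involves i (F j) then mutated_poly F i j P else P = F j) \<and> prime_elem (laurent_of P) \<and>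
      (\<forall>l. \<not> var l dvd P) \<and> \<not> involves j P \<and> (j \<notin> set (s @ [i]) \<longrightarrow> P = exchange_poly (s @ [i]) j)" for j
  proof (cases "j \<in> set (s @ [i])")
    case False
    then have j: "j \<notin> set s" "j \<noteq> i" by auto
    have "involves i (F j)" using D(3)[OF j(1)] i j by (simp add: involves_exchange_poly)
    moreover have "mutated_poly F i j (exchange_poly (s @ [i]) j)"
      by (rule mutated_poly_new[where F = F, OF i Fi hat j D(3)[OF j(1)]])
    moreover have "\<not> involves j (exchange_poly (s @ [i]) j)"
      using j by (intro not_involves_exchange_poly) auto
    ultimately show ?thesis
      using prime_exchange_poly[OF False] not_var_dvd_exchange_poly[of _ "s @ [i]" j] by auto
  next
    case True
    show ?thesis
    proof (cases "involves i (F j)")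
      case False
      then show ?thesis using True prime seed by auto
    next
      case inv_i: True
      then have "j \<noteq> i" using seed(4) by auto
      then have j: "j \<in> set s" using True by simp
      show ?thesis
      proof (cases "j = last s")
        case j_last: True
        have ne: "s \<noteq> []" using j by auto
        then have s: "s = butlast s @ [j]" "j \<notin> set (butlast s)" "F j = exchange_poly (butlast s) j"
          using j_last D(5) last_not_in_butlast[OF D(1)] by auto
        have i': "i \<notin> set (butlast s)" using i by (auto dest: in_set_butlastD)
        have "\<not> involves j (second_poly (butlast s) j i)"
        proof -
          have "butlast s = [] \<or> last (butlast s) \<noteq> j" using s(2) last_in_set by blast
          then show ?thesis
            unfolding second_poly_def last_var_def using \<open>j \<noteq> i\<close>
            by (intro not_involves_intros) auto
        qed
        then show ?thesis
          using mutated_poly_last[where F = F, OF i Fi hat s] prime_second_poly[OF i']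
            not_var_dvd_second_poly[of _ "butlast s" j i] inv_i True by auto
      next
        case False
        have "\<not> involves j (F i)" unfolding Fi using j False by (intro not_involves_exchange_poly) auto
        then obtain P where "mutated_poly F i j P" "prime_elem (laurent_of P)" "\<And>l. \<not> var l dvd P" "\<not> involves j P"
          using mutated_poly_old[where F = F, OF i Fi hat _ seed(4) D(7)[OF j i] prime seed(3)] by blast
        then show ?thesis using inv_i True by auto
      qed
    qed
  qed
  then obtain F' where F': "\<And>j. if involves i (F j) then mutated_poly F i j (F' j) else F' j = F j"
      "\<And>j. prime_elem (laurent_of (F' j))" "\<And>j l. \<not> var l dvd F' j" "\<And>j. \<not> involves j (F' j)"
      "\<And>j. j \<notin> set (s @ [i]) \<Longrightarrow> F' j = exchange_poly (s @ [i]) j"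
    by metis
  define x' where "x' = x(i := leval coeff_in_ratfun x (hat F i) / x i)"
  have "generating_transcendence_basis x'"
    unfolding x'_def hat leval_laurent_of
    by (rule generating_transcendence_basis_exchange[OF seed(1,4)]) (simp add: Fi exchange_poly_nonzero)
  then have "seed (x', F')"
    using F' by (auto simp: seed_def intro: irreducible_if_laurent_prime)
  then have "mutation i (x, F) (x', F')"
    using F'(1) by (simp add: mutation_def x'_def)
  then have "tau (s @ [i]) (x', F')"
    \<comment> \<open>The sign condition holds because a nonzero polynomial with integer
      coefficients differs from its negative.\<close>
    by (rule tau.snoc[OF tau i]) (use F'(5) in \<open>simp add: reference_poly_eq exchange_poly_nonzero\<close>)
  then show ?case using F'(2) by blast
qed

section \<open>The formula in terms of positions in the sequence, and the final equivalence\<close>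

lemma cluster_var_set:
  assumes "distinct s"
  shows "cluster_var (set s) =
         ((\<Sum>i<length s. (\<Prod>j\<in>{..<length s} - {i}. A (s ! j)) * (\<Prod>j\<in>UNIV - {s ! i}. X j))
            + (\<Prod>i<length s. A (s ! i)))
         / (\<Prod>i<length s. X (s ! i))"
proof -
  have bij: "bij_betw ((!) s) {..<length s} (set s)"
    using assms by (rule bij_betw_nth) simp_all
  have bij': "bij_betw ((!) s) ({..<length s} - {i}) (set s - {s ! i})" if "i < length s" for i
  proof -
    have inj: "inj_on ((!) s) {..<length s}" and img: "(!) s ` {..<length s} = set s"
      using bij by (auto simp: bij_betw_def)
    have "(!) s ` ({..<length s} - {i}) = set s - {s ! i}"
      using inj_on_image_set_diff[OF inj, of "{..<length s}" "{i}"] that by (simp add: img)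
    then show ?thesis
      using inj_on_subset[OF inj, of "{..<length s} - {i}"] by (simp add: bij_betw_def)
  qed
  have "(\<Sum>i<length s. (\<Prod>j\<in>{..<length s} - {i}. A (s ! j)) * (\<Prod>j\<in>UNIV - {s ! i}. X j))
      = (\<Sum>i<length s. (\<Prod>j\<in>set s - {s ! i}. A j) * (\<Prod>j\<in>UNIV - {s ! i}. X j))"
  proof (intro sum.cong refl)
    fix i assume "i \<in> {..<length s}"
    then have "(\<Prod>j\<in>{..<length s} - {i}. A (s ! j)) = (\<Prod>j\<in>set s - {s ! i}. A j)"
      by (intro prod.reindex_bij_betw bij') simp
    then show "(\<Prod>j\<in>{..<length s} - {i}. A (s ! j)) * (\<Prod>j\<in>UNIV - {s ! i}. X j)
        = (\<Prod>j\<in>set s - {s ! i}. A j) * (\<Prod>j\<in>UNIV - {s ! i}. X j)" by simp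
  qed simp
  also have "\<dots> = (\<Sum>i\<in>set s. (\<Prod>j\<in>set s - {i}. A j) * (\<Prod>j\<in>UNIV - {i}. X j))"
    by (rule sum.reindex_bij_betw[OF bij])
  finally show ?thesis
    by (simp add: cluster_var_def prod.reindex_bij_betw[OF bij])
qed

lemma tau_last_cluster_var:
  assumes "tau s S" "s \<noteq> []"
  shows "fst S (last s) = cluster_var (set s)"
  using tau_invD(6)[of s "fst S" "snd S"] tau_inv[OF assms(1)] assms(2) by simp

theorem corollary4p3:
  fixes s s' :: "'n::{finite,linorder} list"
  assumes "distinct s" "s \<noteq> []" and "distinct s'" "s' \<noteq> []"
  shows "(\<exists>S. tau s S) \<and>
    (\<forall>S. tau s S \<longrightarrow>
       fst S (last s) =
         ((\<Sum>i<length s. (\<Prod>j\<in>{..<length s} - {i}. A (s ! j)) * (\<Prod>j\<in>UNIV - {s ! i}. X j))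
            + (\<Prod>i<length s. A (s ! i)))
         / (\<Prod>i<length s. X (s ! i))) \<and>
    (\<forall>S S'. tau s S \<longrightarrow> tau s' S' \<longrightarrow>
       (fst S (last s) = fst S' (last s') \<longleftrightarrow> set s = set s'))"
proof (intro conjI allI impI)
  show "\<exists>S. tau s S" using tau_exists[OF assms(1)] by blast
next
  fix S assume "tau s S"
  then show "fst S (last s) =
      ((\<Sum>i<length s. (\<Prod>j\<in>{..<length s} - {i}. A (s ! j)) * (\<Prod>j\<in>UNIV - {s ! i}. X j))
         + (\<Prod>i<length s. A (s ! i)))
      / (\<Prod>i<length s. X (s ! i))"
    by (simp only: tau_last_cluster_var assms cluster_var_set simp_thms)
next
  fix S S' assume "tau s S" "tau s' S'"
  then show "fst S (last s) = fst S' (last s') \<longleftrightarrow> set s = set s'"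
    by (simp only: tau_last_cluster_var assms cluster_var_inject simp_thms)
qed

end
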